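(* Let $F$ be a full vertex algebra. Then $\ker\bar D$ (with the restriction of $Y$ and the vacuum $\mathbf 1$) is a vertex algebra and $F$ is a $\ker\bar D$-module.
   Context: **Formal series.** The base field is $\mathbb C$. $z,\bar z$ are independent formal variables (also used for a complex number and its conjugate), $\underline z=(z,\bar z)$, and by convention $|z|:=z\bar z$, so $|z|^r=z^r\bar z^r$. For a vector space $W$: $W[[z,\bar z,|z|^{\mathbb R}]]$ is the space of formal sums $\sum_{s,\bar s\in\mathbb R}a_{s,\bar s}z^s\bar z^{\bar s}$ with $a_{s,\bar s}\in W$ and $a_{s,\bar s}=0$ unless $s-\bar s\in\mathbb Z$; $W[[z,\bar z]]$ is the subspace of sums over $s,\bar s\in\mathbb Z_{\ge0}$; $W((z,\bar z,|z|^{\mathbb R}))$ is the subspace of series such that (i) there is $N\in\mathbb R$ with $a_{s,\bar s}=0$ if $s\le N$ or $\bar s\le N$, and (ii) for every $R\in\mathbb R$ the set $\{(s,\bar s): a_{s,\bar s}\ne0,\ s+\bar s\le R\}$ is finite. A series in $\mathbb C((z,\bar z,|z|^{\mathbb R}))$ is absolutely convergent around $0$ if, after multiplication by some $|z|^N$ making all exponents nonnegative, $\sum|a_{s,\bar s}|R^{s+\bar s}<\infty$ for some $R>0$. **Correlation functions.** $F_{0,1,\infty}$ is the space of complex-valued real analytic functions $f$ on $\mathbb CP^1\setminus\{0,1,\infty\}$ with conformal singularities at $0,1,\infty$: for each $\alpha\in\{0,1,\infty\}$ and each chart $\chi$ (biholomorphism from a neighbourhood of $\alpha$ to an open subset of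 $\mathbb C$, $\chi(\alpha)=0$) there is a series in $\mathbb C((z,\bar z,|z|^{\mathbb R}))$, absolutely convergent around $0$, converging to $f\circ\chi^{-1}(z)$ on a punctured disc at $0$; this (unique) series is denoted $j(\chi,f)$. Let $Y_2=\{(z_1,z_2)\in\mathbb C^2: z_1\ne z_2,z_1\ne0,z_2\neq0\}$ and let $\mathrm{GCor}_2$ be the span of the functions $\mu=z_1^\alpha\bar z_1^\beta f(z_2/z_1)$ on $Y_2$, $f\in F_{0,1,\infty}$, $\alpha,\beta\in\mathbb R$, $\alpha-\beta\in\mathbb Z$. Its expansions are (with $z_0=z_1-z_2$): $\mu|_{|z_1|>|z_2|}=z_1^\alpha\bar z_1^\beta\,j(z,f)|_{z=z_2/z_1}$; $\mu|_{|z_2|>|z_1|}=z_1^\alpha\bar z_1^\beta\,j(z^{-1},f)|_{z=z_1/z_2}$; $\mu|_{|z_2|>|z_1-z_2|}=z_2^\alpha\bar z_2^\beta\sum_{i,k\ge0}\binom\alpha i\binom\beta k(z_0/z_2)^i(\bar z_0/\bar z_2)^k\,j(1-z^{-1},f)|_{z=-z_0/z_2}$, where $z\mapsto -z_0/z_2$ sends $z^s\bar z^{\bar s}$ to $(-1)^{s-\bar s}(z_0/z_2)^s(\bar z_0/\bar z_2)^{\bar s}$. **Full vertex algebra.** An $\mathbb R^2$-graded vector space $F=\bigoplus_{h,\bar h\in\mathbb R}F_{h,\bar h}$ with a linear map $Y(-,\underline z):F\to\mathrm{End}(F)[[z,\bar z,|z|^{\mathbb R}]]$, $Y(a,\underline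 z)=\sum_{r,s\in\mathbb R}a(r,s)z^{-r-1}\bar z^{-s-1}$, and $\mathbf 1\in F_{0,0}$ such that, with $F^\vee=\bigoplus F_{h,\bar h}^*$: (FV1) $Y(a,\underline z)b\in F((z,\bar z,|z|^{\mathbb R}))$; (FV2) $F_{h,\bar h}=0$ unless $h-\bar h\in\mathbb Z$; (FV3) $Y(a,\underline z)\mathbf 1\in F[[z,\bar z]]$ with constant term $a(-1,-1)\mathbf 1=a$; (FV4) $Y(\mathbf 1,\underline z)=\mathrm{id}$; (FV5) for all $a,b,c\in F$, $u\in F^\vee$ there is $\mu\in\mathrm{GCor}_2$ with $u(Y(a,\underline z_1)Y(b,\underline z_2)c)=\mu|_{|z_1|>|z_2|}$, $u(Y(Y(a,\underline z_0)b,\underline z_2)c)=\mu|_{|z_2|>|z_1-z_2|}$, $u(Y(b,\underline z_2)Y(a,\underline z_1)c)=\mu|_{|z_2|>|z_1|}$; (FV6) for $a\in F_{h,\bar h}$, $a(r,s)F_{h',\bar h'}\subset F_{h+h'-r-1,\bar h+\bar h'-s-1}$. Put $Da=a(-2,-1)\mathbf 1$, $\bar Da=a(-1,-2)\mathbf 1$. For $a\in\ker\bar D$ one has $Y(a,\underline z)=\sum_{n\in\mathbb Z}a(n,-1)z^{-n-1}=:Y(a,z)$, and the vertex algebra and module structures are given by the products $a(n,-1)$, $n\in\mathbb Z$. *)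

theory Defs
  imports "HOL-Analysis.Analysis" "HOL-Library.Groups_Big_Fun"
begin

section \<open>Formal series in $z$, $\bar z$ with real exponents\<close>

text \<open>
  A formal sum over \<open>s, t \<in> \<real>\<close> of \<open>a s t z^s zbar^t\<close> is represented by its coefficient function
  \<open>a\<close>. The set \<open>formal_series\<close> is W[[z, zbar, |z|^R]], \<open>power_series\<close> is W[[z, zbar]] and
  \<open>laurent_series\<close> is W((z, zbar, |z|^R)).
\<close>

type_synonym 'w coeffs = "real \<Rightarrow> real \<Rightarrow> 'w"

definition formal_series :: "'w::zero coeffs set" where
  "formal_series = {a. \<forall>s t. a s t \<noteq> 0 \<longrightarrow> s - t \<in> \<int>}"

definition power_series :: "'w::zero coeffs set" where
  "power_series = {a. \<forall>s t. a s t \<noteq> 0 \<longrightarrow> s \<in> \<nat> \<and> t \<in> \<nat>}"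

definition laurent_series :: "'w::zero coeffs set" where
  "laurent_series = {a \<in> formal_series.
     (\<exists>N. \<forall>s t. s \<le> N \<or> t \<le> N \<longrightarrow> a s t = 0) \<and>
     (\<forall>R. finite {(s, t). a s t \<noteq> 0 \<and> s + t \<le> R})}"

text \<open>In the next definition \<open>N\<close> is the exponent of the factor |z|^N = z^N zbar^N.\<close>

definition abs_convergent :: "complex coeffs \<Rightarrow> bool" where
  "abs_convergent a \<longleftrightarrow> (\<exists>N R. R > 0 \<and>
     (\<forall>s t. a s t \<noteq> 0 \<longrightarrow> s + N \<ge> 0 \<and> t + N \<ge> 0) \<and>
     (\<lambda>(s, t). norm (a s t) * R powr ((s + N) + (t + N))) summable_on UNIV)"

text \<open>
  The value of z^s zbar^t at a complex number \<open>z \<noteq> 0\<close>, for \<open>s - t \<in> \<int>\<close>. It is single-valued, being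
  z^(s - t) (z zbar)^t.
\<close>

definition zpow :: "complex \<Rightarrow> real \<Rightarrow> real \<Rightarrow> complex" where
  "zpow z s t = z powi \<lfloor>s - t\<rfloor> * complex_of_real ((cmod z ^ 2) powr t)"

definition expands_as :: "(complex \<Rightarrow> complex) \<Rightarrow> complex coeffs \<Rightarrow> bool" where
  "expands_as g a \<longleftrightarrow> a \<in> laurent_series \<and> abs_convergent a \<and>
     (\<exists>\<epsilon>>0. \<forall>z. 0 < cmod z \<and> cmod z < \<epsilon> \<longrightarrow> ((\<lambda>(s, t). a s t * zpow z s t) has_sum g z) UNIV)"


section \<open>Functions with conformal singularities\<close>

definition real_analytic :: "(complex \<Rightarrow> complex) \<Rightarrow> complex set \<Rightarrow> bool" where
  "real_analytic f S \<longleftrightarrow> (\<forall>z0\<in>S. \<exists>r>0. \<exists>c :: nat \<Rightarrow> nat \<Rightarrow> complex. \<forall>z\<in>ball z0 r.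
     ((\<lambda>(m, n). c m n * complex_of_real (Re (z - z0) ^ m * Im (z - z0) ^ n)) has_sum f z) UNIV)"

definition chart_at :: "complex \<Rightarrow> complex set \<Rightarrow> (complex \<Rightarrow> complex) \<Rightarrow> bool" where
  "chart_at \<alpha> U \<phi> \<longleftrightarrow> open U \<and> \<alpha> \<in> U \<and> \<phi> holomorphic_on U \<and> inj_on \<phi> U \<and> \<phi> \<alpha> = 0"

definition conformal_singularity :: "(complex \<Rightarrow> complex) \<Rightarrow> complex \<Rightarrow> bool" where
  "conformal_singularity f \<alpha> \<longleftrightarrow>
     (\<forall>U \<phi>. chart_at \<alpha> U \<phi> \<longrightarrow> (\<exists>a. expands_as (f \<circ> inv_into U \<phi>) a))"

text \<open>
  A function on CP^1 minus \<open>{0, 1, \<infinity>}\<close> is a function on the complex numbers whose values at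
  0 and 1 are irrelevant. The charts of CP^1 at infinity are the \<open>z \<mapsto> \<phi> (1/z)\<close> with \<open>\<phi>\<close> a chart
  at 0, so the condition at infinity on \<open>f\<close> is the condition at 0 on \<open>z \<mapsto> f (1/z)\<close>.
\<close>

definition F01inf :: "(complex \<Rightarrow> complex) set" where
  "F01inf = {f. real_analytic f (- {0, 1}) \<and>
     conformal_singularity f 0 \<and> conformal_singularity f 1 \<and>
     conformal_singularity (\<lambda>z. f (1 / z)) 0}"


section \<open>The space GCor2 and its expansions\<close>

text \<open>
  A formal series in two variables \<open>x, y\<close> and their conjugates is represented by its
  coefficients: \<open>e p p' q q'\<close> is the coefficient of x^p xbar^p' y^q ybar^q'. The next three
  functions give the expansions of z1^\<open>\<alpha>\<close> z1bar^\<open>\<beta>\<close> f(z2/z1) in the regions |z1| > |z2|,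
  |z2| > |z1| (both in the variables z1, z2) and |z2| > |z1 - z2| (in z0 = z1 - z2 and z2),
  where \<open>a\<close> is the expansion of \<open>f\<close> in the chart z, z^(-1) and 1 - z^(-1), respectively.
\<close>

type_synonym coeffs2 = "real \<Rightarrow> real \<Rightarrow> real \<Rightarrow> real \<Rightarrow> complex"

definition expansion_12 :: "real \<Rightarrow> real \<Rightarrow> complex coeffs \<Rightarrow> coeffs2" where
  "expansion_12 \<alpha> \<beta> a = (\<lambda>p p' q q'. if p = \<alpha> - q \<and> p' = \<beta> - q' then a q q' else 0)"

definition expansion_21 :: "real \<Rightarrow> real \<Rightarrow> complex coeffs \<Rightarrow> coeffs2" where
  "expansion_21 \<alpha> \<beta> a = (\<lambda>p p' q q'. if p = \<alpha> - q \<and> p' = \<beta> - q' then a (- q) (- q') else 0)"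

text \<open>
  Here \<open>a\<close> is evaluated at -z0/z2, the summation index is (i, k), and the exponents of z0/z2
  and its conjugate contributed by \<open>a\<close> are p - i and p' - k. Since the exponents of \<open>a\<close> are
  bounded below, only finitely many (i, k) contribute.
\<close>

definition expansion_02 :: "real \<Rightarrow> real \<Rightarrow> complex coeffs \<Rightarrow> coeffs2" where
  "expansion_02 \<alpha> \<beta> a = (\<lambda>p p' q q'. if q = \<alpha> - p \<and> q' = \<beta> - p' then
     Sum_any (\<lambda>(i, k). complex_of_real ((\<alpha> gchoose i) * (\<beta> gchoose k)) *
       (- 1) powi \<lfloor>(p - real i) - (p' - real k)\<rfloor> * a (p - real i) (p' - real k)) else 0)"

text \<open>
  \<open>gcor2 \<mu> e12 e02 e21\<close>: the function \<open>\<mu>\<close> on Y_2 (set to 0 off Y_2) belongs to GCor2 and has the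
  expansions \<open>e12\<close>, \<open>e02\<close>, \<open>e21\<close> in |z1| > |z2|, |z2| > |z1 - z2| and |z2| > |z1|. The expansions
  are extended linearly from the generators to their span. In the generators, \<open>a0\<close>, \<open>a1\<close>,
  \<open>ainf\<close> are the expansions of \<open>f\<close> in the charts z at 0, 1 - z^(-1) at 1 and z^(-1) at infinity,
  whose inverses are w, 1/(1 - w) and 1/w.
\<close>

inductive gcor2 :: "(complex \<Rightarrow> complex \<Rightarrow> complex) \<Rightarrow> coeffs2 \<Rightarrow> coeffs2 \<Rightarrow> coeffs2 \<Rightarrow> bool" where
  generator: "\<lbrakk>f \<in> F01inf; \<alpha> - \<beta> \<in> \<int>; expands_as f a0;
     expands_as (\<lambda>w. f (1 / (1 - w))) a1; expands_as (\<lambda>w. f (1 / w)) ainf\<rbrakk> \<Longrightarrow>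
   gcor2 (\<lambda>z1 z2. if z1 \<noteq> z2 \<and> z1 \<noteq> 0 \<and> z2 \<noteq> 0 then zpow z1 \<alpha> \<beta> * f (z2 / z1) else 0)
     (expansion_12 \<alpha> \<beta> a0) (expansion_02 \<alpha> \<beta> a1) (expansion_21 \<alpha> \<beta> ainf)"
| zero: "gcor2 (\<lambda>_ _. 0) (\<lambda>_ _ _ _. 0) (\<lambda>_ _ _ _. 0) (\<lambda>_ _ _ _. 0)"
| add: "gcor2 \<mu> e12 e02 e21 \<Longrightarrow> gcor2 \<nu> d12 d02 d21 \<Longrightarrow>
   gcor2 (\<lambda>z1 z2. \<mu> z1 z2 + \<nu> z1 z2)
     (\<lambda>p p' q q'. e12 p p' q q' + d12 p p' q q')
     (\<lambda>p p' q q'. e02 p p' q q' + d02 p p' q q')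
     (\<lambda>p p' q q'. e21 p p' q q' + d21 p p' q q')"
| scale: "gcor2 \<mu> e12 e02 e21 \<Longrightarrow>
   gcor2 (\<lambda>z1 z2. c * \<mu> z1 z2)
     (\<lambda>p p' q q'. c * e12 p p' q q')
     (\<lambda>p p' q q'. c * e02 p p' q q')
     (\<lambda>p p' q q'. c * e21 p p' q q')"


section \<open>Full vertex algebras\<close>

text \<open>The whole space is the internal direct sum of the subspaces \<open>grade h h'\<close>.\<close>

definition graded_by ::
  "(complex \<Rightarrow> 'v \<Rightarrow> 'v) \<Rightarrow> (real \<Rightarrow> real \<Rightarrow> 'v::ab_group_add set) \<Rightarrow> bool" where
  "graded_by sc grade \<longleftrightarrow> (\<forall>h h'. module.subspace sc (grade h h')) \<and>
     (\<forall>v. \<exists>!x :: real \<times> real \<Rightarrow> 'v. (\<forall>h h'. x (h, h') \<in> grade h h') \<and>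
        finite {d. x d \<noteq> 0} \<and> Sum_any x = v)"

text \<open>
  The direct sum of the duals of the \<open>grade h h'\<close>, viewed as the space of those functionals on
  the whole space that vanish on all but finitely many \<open>grade h h'\<close>.
\<close>

definition restricted_dual ::
  "(complex \<Rightarrow> 'v \<Rightarrow> 'v) \<Rightarrow> (real \<Rightarrow> real \<Rightarrow> 'v::ab_group_add set) \<Rightarrow> ('v \<Rightarrow> complex) set" where
  "restricted_dual sc grade = {u. Vector_Spaces.linear sc (*) u \<and>
     finite {(h, h'). \<exists>v\<in>grade h h'. u v \<noteq> 0}}"

text \<open>
  \<open>Y a r s\<close> is the mode a(r, s), i.e. the coefficient of z^(-r-1) zbar^(-s-1) in Y(a, z); so the
  coefficient of z^p zbar^q is \<open>Y a (- p - 1) (- q - 1)\<close>.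
\<close>

locale full_vertex_algebra = vector_space sc
  for sc :: "complex \<Rightarrow> 'v::ab_group_add \<Rightarrow> 'v" +
  fixes grade :: "real \<Rightarrow> real \<Rightarrow> 'v set"
    and vac :: 'v
    and Y :: "'v \<Rightarrow> real \<Rightarrow> real \<Rightarrow> 'v \<Rightarrow> 'v"
  assumes graded: "graded_by sc grade"
    and vac_grade: "vac \<in> grade 0 0"
    and Y_linear: "Vector_Spaces.linear sc sc (\<lambda>a. Y a r s b)"
    and mode_linear: "Vector_Spaces.linear sc sc (Y a r s)"
    and Y_formal: "(\<lambda>p q. Y a (- p - 1) (- q - 1) b) \<in> formal_series"
    and FV1: "(\<lambda>p q. Y a (- p - 1) (- q - 1) b) \<in> laurent_series"
    and FV2: "h - h' \<notin> \<int> \<Longrightarrow> grade h h' = {0}"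
    and FV3: "(\<lambda>p q. Y a (- p - 1) (- q - 1) vac) \<in> power_series" "Y a (- 1) (- 1) vac = a"
    and FV4: "Y vac r s b = (if r = - 1 \<and> s = - 1 then b else 0)"
    and FV5: "u \<in> restricted_dual sc grade \<Longrightarrow> \<exists>\<mu>. gcor2 \<mu>
       (\<lambda>p p' q q'. u (Y a (- p - 1) (- p' - 1) (Y b (- q - 1) (- q' - 1) c)))
       (\<lambda>p p' q q'. u (Y (Y a (- p - 1) (- p' - 1) b) (- q - 1) (- q' - 1) c))
       (\<lambda>p p' q q'. u (Y b (- q - 1) (- q' - 1) (Y a (- p - 1) (- p' - 1) c)))"
    and FV6: "a \<in> grade h h' \<Longrightarrow> b \<in> grade k k' \<Longrightarrow>
       Y a r s b \<in> grade (h + k - r - 1) (h' + k' - s - 1)"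

definition Dbar :: "'v \<Rightarrow> ('v \<Rightarrow> real \<Rightarrow> real \<Rightarrow> 'v \<Rightarrow> 'v) \<Rightarrow> 'v \<Rightarrow> 'v" where
  "Dbar vac Y a = Y a (- 1) (- 2) vac"

definition ker_Dbar :: "'v::zero \<Rightarrow> ('v \<Rightarrow> real \<Rightarrow> real \<Rightarrow> 'v \<Rightarrow> 'v) \<Rightarrow> 'v set" where
  "ker_Dbar vac Y = {a. Dbar vac Y a = 0}"


section \<open>Vertex algebras and their modules\<close>

text \<open>
  Vertex algebras and modules live on subspaces \<open>V\<close>, \<open>W\<close> of ambient vector spaces; \<open>nprod a n b\<close>
  and \<open>act a n w\<close> are the n-th products, so that Y(a, z) is the sum of the \<open>nprod a n\<close> z^(-n-1).
  In the Borcherds identity, the sums over \<open>i :: nat\<close> are finite by the truncation condition.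
\<close>

definition vertex_module ::
  "(complex \<Rightarrow> 'v::ab_group_add \<Rightarrow> 'v) \<Rightarrow> 'v set \<Rightarrow> 'v \<Rightarrow> ('v \<Rightarrow> int \<Rightarrow> 'v \<Rightarrow> 'v) \<Rightarrow>
   (complex \<Rightarrow> 'w::ab_group_add \<Rightarrow> 'w) \<Rightarrow> 'w set \<Rightarrow> ('v \<Rightarrow> int \<Rightarrow> 'w \<Rightarrow> 'w) \<Rightarrow> bool" where
  "vertex_module sc V vac nprod scW W act \<longleftrightarrow>
     vector_space scW \<and> module.subspace scW W \<and>
     (\<forall>a\<in>V. \<forall>w\<in>W. \<forall>n. act a n w \<in> W) \<and>
     (\<forall>a\<in>V. \<forall>b\<in>V. \<forall>w\<in>W. \<forall>n. act (a + b) n w = act a n w + act b n w) \<and>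
     (\<forall>a\<in>V. \<forall>w\<in>W. \<forall>n c. act (sc c a) n w = scW c (act a n w)) \<and>
     (\<forall>a\<in>V. \<forall>v\<in>W. \<forall>w\<in>W. \<forall>n. act a n (v + w) = act a n v + act a n w) \<and>
     (\<forall>a\<in>V. \<forall>w\<in>W. \<forall>n c. act a n (scW c w) = scW c (act a n w)) \<and>
     (\<forall>a\<in>V. \<forall>w\<in>W. \<exists>N. \<forall>n\<ge>N. act a n w = 0) \<and>
     (\<forall>w\<in>W. \<forall>n. act vac n w = (if n = - 1 then w else 0)) \<and>
     (\<forall>a\<in>V. \<forall>b\<in>V. \<forall>w\<in>W. \<forall>p q r :: int.
        Sum_any (\<lambda>i. scW (of_int p gchoose i) (act (nprod a (r + int i) b) (p + q - int i) w)) =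
        Sum_any (\<lambda>i. scW ((- 1) ^ i * (of_int r gchoose i))
          (act a (p + r - int i) (act b (q + int i) w)
           - scW ((- 1) powi r) (act b (q + r - int i) (act a (p + int i) w)))))"

text \<open>
  The axioms of a vertex algebra are those of a module for the adjoint action, together with
  the creation property.
\<close>

definition vertex_algebra ::
  "(complex \<Rightarrow> 'v::ab_group_add \<Rightarrow> 'v) \<Rightarrow> 'v set \<Rightarrow> 'v \<Rightarrow> ('v \<Rightarrow> int \<Rightarrow> 'v \<Rightarrow> 'v) \<Rightarrow> bool" where
  "vertex_algebra sc V vac nprod \<longleftrightarrow> vac \<in> V \<and> vertex_module sc V vac nprod sc V nprod \<and>
     (\<forall>a\<in>V. nprod a (- 1) vac = a \<and> (\<forall>n\<ge>0. nprod a n vac = 0))"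

end

theory Submission
  imports Defs "HOL-Complex_Analysis.Complex_Analysis"
begin

text \<open>
  Fix \<open>u\<close> in the restricted dual and vectors \<open>a, b, c\<close>. Splitting the correlation function of
  FV5 into its homogeneous components produces, for each pair of degrees \<open>(\<alpha>, \<beta>)\<close>, one function
  \<open>f\<close> on the sphere minus 0, 1 and \<open>\<infinity>\<close> whose expansions at the three punctures are the matrix
  elements of degree \<open>(\<alpha>, \<beta>)\<close> of \<open>Y(a)Y(b)\<close>, \<open>Y(Y(a)b)\<close> and \<open>Y(b)Y(a)\<close>
  (lemmas \<open>gcor2_homogeneous_component\<close> and \<open>correlator\<close>). As the restricted dual separates
  points, every claim about modes is a claim about coefficients of such expansions.

  The coefficients at different punctures are tied together by analytic continuation. The analytic
  input is that a real analytic function on a connected open set which is holomorphic near one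
  point is holomorphic everywhere (\<open>real_analytic_holomorphic_continuation\<close>).

  For \<open>b = 1\<close> the expansion at 0 is a constant \<open>C\<close>, a matrix element of a mode of \<open>a\<close>, so
  \<open>f = C\<close>, and the expansion at 1 is \<open>C (1 + x)^\<alpha> (1 + xbar)^\<beta>\<close>. Its coefficient at \<open>xbar\<close> is
  \<open>\<beta> C\<close> on the one hand and a matrix element of \<open>Y(Dbar a)\<close> on the other. If \<open>Dbar a = 0\<close>, this
  leaves only \<open>\<beta> = 0\<close>, which says that only the modes \<open>a(n, -1)\<close> with integral \<open>n\<close> survive
  (\<open>ker_Dbar_modes\<close>). If \<open>a\<close> and \<open>b\<close> are both in the kernel and \<open>\<beta> = 1\<close>, the same argument with
  \<open>f = 0\<close> shows that \<open>a(n, -1) b\<close> is in the kernel (\<open>ker_Dbar_closed\<close>).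

  For \<open>a, b\<close> in the kernel and \<open>\<beta> = 0\<close> the expansions at 0, 1 and \<open>\<infinity>\<close> are Laurent series in \<open>z\<close>
  alone. So \<open>f\<close> is holomorphic with at most poles at the punctures, and the Borcherds identity is the
  statement that the residues of \<open>z^p (z - 1)^r z^\<alpha> f(1/z) dz\<close> add up to zero, after expanding
  the powers of \<open>z\<close> and \<open>z - 1\<close> binomially at each puncture (\<open>three_point_coefficient_identity\<close>).
\<close>

section \<open>Holomorphic continuation of real analytic functions\<close>

lemma islimpt_real_direction:
  fixes p :: complex
  assumes "0 < d" and "\<And>t. 0 < t \<Longrightarrow> t < d \<Longrightarrow> p + of_real t \<in> U"
  shows "p islimpt U"
  unfolding islimpt_approachable
proof (intro allI impI)
  fix e :: real assume "0 < e"
  define t where "t = min d e / 2"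
  have t: "0 < t" "t < d" "t < e" using \<open>0 < e\<close> assms(1) by (auto simp: t_def)
  have "dist (p + of_real t) p < e" using t by (simp add: dist_norm)
  then show "\<exists>x'\<in>U. x' \<noteq> p \<and> dist x' p < e"
    using assms(2)[OF t(1,2)] t by (intro bexI[of _ "p + of_real t"]) auto
qed

text \<open>
  Summing over \<open>n\<close> first turns the double series into a power series in \<open>X\<close>.
\<close>

lemma double_power_series_holomorphic:
  fixes c :: "nat \<Rightarrow> nat \<Rightarrow> complex"
  assumes "0 < \<rho>"
    and sum: "\<And>X. cmod X < \<rho> \<Longrightarrow> ((\<lambda>(m, n). c m n * X ^ m * Y ^ n) has_sum G X) UNIV"
  shows "G holomorphic_on ball 0 \<rho>"
proof -
  define s where "s m = (\<Sum>\<^sub>\<infinity>n. c m n * Y ^ n)" for m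
  have inner: "((\<lambda>n. c m n * Y ^ n) has_sum s m) UNIV" for m
  proof -
    define X where "X = complex_of_real (\<rho> / 2)"
    have X: "X \<noteq> 0" "cmod X < \<rho>" using assms(1) by (auto simp: X_def)
    have "(\<lambda>(m, n). c m n * X ^ m * Y ^ n) summable_on UNIV \<times> UNIV"
      using sum[OF X(2)] by (auto simp: summable_on_def)
    then have "(\<lambda>n. c m n * X ^ m * Y ^ n) summable_on UNIV"
      by (rule summable_on_SigmaD1) auto
    then have "(\<lambda>n. X ^ m * (c m n * Y ^ n)) summable_on UNIV"
      by (simp add: mult_ac)
    then have "(\<lambda>n. c m n * Y ^ n) summable_on UNIV"
      using X by (subst (asm) summable_on_cmult_right') auto
    then show ?thesis unfolding s_def by (rule has_sum_infsum)
  qed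
  have "(\<lambda>m. s m * (X - 0) ^ m) sums G X" if "X \<in> ball 0 \<rho>" for X
  proof (rule has_sum_imp_sums, rule has_sum_SigmaD[where B = "\<lambda>_. UNIV"])
    show "((\<lambda>(m, n). c m n * X ^ m * Y ^ n) has_sum G X) (UNIV \<times> UNIV)"
      using sum[of X] that by simp
    show "((\<lambda>n. (case (m, n) of (m, n) \<Rightarrow> c m n * X ^ m * Y ^ n)) has_sum s m * (X - 0) ^ m) UNIV" for m
      using has_sum_cmult_left[OF inner[of m], of "X ^ m"] by (simp add: mult_ac)
  qed
  then show ?thesis by (rule power_series_holomorphic)
qed

text \<open>
  The double series also converges for complex values \<open>X\<close>, \<open>Y\<close> of the two real coordinates and gives
  a function \<open>F(X, Y)\<close> holomorphic in each variable. Where \<open>f\<close> is holomorphic, the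
  Cauchy-Riemann equations make \<open>F(X, Y)\<close> depend on \<open>X + \<i> Y\<close> only. This can be said without
  derivatives: \<open>w \<mapsto> F(w - \<i> y, y)\<close> agrees with \<open>f\<close> on a line segment, hence does not depend on \<open>y\<close>,
  for \<open>y\<close> in a small real interval. The one-variable identity theorem carries the resulting relation
  \<open>F(X, Y) = \<Psi>(X + \<i> Y)\<close> to all \<open>X\<close>, \<open>Y\<close> near 0, and restricting to real \<open>X\<close>, \<open>Y\<close> shows
  that \<open>f\<close> is the holomorphic function \<open>\<Psi>\<close>.
\<close>

lemma real_analytic_holomorphic_spreads_at_0:
  fixes c :: "nat \<Rightarrow> nat \<Rightarrow> complex"
  assumes "0 < \<rho>"
    and sum: "\<And>z. cmod z < 2 * \<rho> \<Longrightarrow>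
      ((\<lambda>(m, n). c m n * complex_of_real (Re z ^ m * Im z ^ n)) has_sum f z) UNIV"
    and z1: "cmod z1 < \<rho> / 4" and "0 < \<delta>" and holo: "f holomorphic_on ball z1 \<delta>"
  shows "f holomorphic_on ball 0 (\<rho> / 4)"
proof -
  define F where "F X Y = (\<Sum>\<^sub>\<infinity>(m, n). c m n * X ^ m * Y ^ n)" for X Y
  have Fsum: "((\<lambda>(m, n). c m n * X ^ m * Y ^ n) has_sum F X Y) UNIV"
    if "cmod X \<le> \<rho>" "cmod Y \<le> \<rho>" for X Y
  proof -
    \<comment> \<open>convergence at the corner \<open>\<rho> + \<i> \<rho>\<close> dominates the series on the polydisc of radius \<open>\<rho>\<close>\<close>
    have "cmod (Complex \<rho> \<rho>) < 2 * \<rho>"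
      using \<open>0 < \<rho>\<close> by (auto simp: cmod_def power2_eq_square intro!: real_less_lsqrt)
    from sum[OF this]
    have "(\<lambda>p. case p of (m, n) \<Rightarrow> c m n * complex_of_real (\<rho> ^ m * \<rho> ^ n)) summable_on UNIV"
      by (auto simp: summable_on_def)
    then have *: "Infinite_Sum.abs_summable_on (\<lambda>p. case p of (m, n) \<Rightarrow> c m n * complex_of_real (\<rho> ^ m * \<rho> ^ n)) UNIV"
      by (simp add: summable_on_iff_abs_summable_on_complex)
    have "Infinite_Sum.abs_summable_on (\<lambda>p. case p of (m, n) \<Rightarrow> c m n * X ^ m * Y ^ n) UNIV"
    proof (rule Infinite_Sum.abs_summable_on_comparison_test[OF *], safe)
      fix m n
      have "cmod X ^ m * cmod Y ^ n \<le> \<rho> ^ m * \<rho> ^ n"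
        using that \<open>0 < \<rho>\<close> by (intro mult_mono power_mono) auto
      then show "cmod (c m n * X ^ m * Y ^ n) \<le> cmod (c m n * complex_of_real (\<rho> ^ m * \<rho> ^ n))"
        using \<open>0 < \<rho>\<close>
        by (simp add: norm_mult norm_power mult.assoc mult_left_mono abs_mult power_abs)
    qed
    then show ?thesis unfolding F_def
      by (intro has_sum_infsum) (rule abs_summable_summable)
  qed
  have FX: "(\<lambda>X. F X Y) holomorphic_on ball 0 \<rho>" if "cmod Y < \<rho>" for Y
    using that \<open>0 < \<rho>\<close> by (intro double_power_series_holomorphic[of \<rho> c Y] Fsum) auto
  have FY: "F X holomorphic_on ball 0 \<rho>" if "cmod X < \<rho>" for X
  proof (rule double_power_series_holomorphic[of \<rho> "\<lambda>n m. c m n" X])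
    fix Y assume "cmod Y < \<rho>"
    with that have "((\<lambda>(m, n). c m n * X ^ m * Y ^ n) has_sum F X Y) (UNIV \<times> UNIV)"
      using Fsum[of X Y] by simp
    then show "((\<lambda>(m, n). c n m * Y ^ m * X ^ n) has_sum F X Y) UNIV"
      by (subst (asm) has_sum_swap) (simp add: mult_ac)
  qed fact
  have fF: "f z = F (of_real (Re z)) (of_real (Im z))" if "cmod z < \<rho>" for z
  proof -
    have "((\<lambda>(m, n). c m n * complex_of_real (Re z ^ m * Im z ^ n)) has_sum
        F (of_real (Re z)) (of_real (Im z))) UNIV"
      using Fsum[of "of_real (Re z)" "of_real (Im z)"] that abs_Re_le_cmod[of z] abs_Im_le_cmod[of z]
      by (simp add: mult_ac)
    moreover have "((\<lambda>(m, n). c m n * complex_of_real (Re z ^ m * Im z ^ n)) has_sum f z) UNIV"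
      using that \<open>0 < \<rho>\<close> by (intro sum) auto
    ultimately show ?thesis using has_sum_unique by blast
  qed
  define \<Phi> where "\<Phi> y w = F (w - \<i> * of_real y) (of_real y)" for y :: real and w
  have \<Phi>_holo: "\<Phi> y holomorphic_on ball 0 (\<rho> / 2)" if "\<bar>y\<bar> < \<rho> / 2" for y
  proof -
    have "((\<lambda>X. F X (of_real y)) \<circ> (\<lambda>w. w - \<i> * of_real y)) holomorphic_on ball 0 (\<rho> / 2)"
    proof (rule holomorphic_on_compose_gen[OF _ FX])
      show "(\<lambda>w. w - \<i> * of_real y) ` ball 0 (\<rho> / 2) \<subseteq> ball 0 \<rho>"
      proof safe
        fix w :: complex assume "w \<in> ball 0 (\<rho> / 2)"
        then show "w - \<i> * of_real y \<in> ball 0 \<rho>"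
          using norm_triangle_ineq4[of w "\<i> * of_real y"] that by (simp add: norm_mult)
      qed
    qed (use that \<open>0 < \<rho>\<close> in \<open>auto intro!: holomorphic_intros\<close>)
    then show ?thesis by (simp add: o_def \<Phi>_def[abs_def])
  qed
  \<comment> \<open>small enough for the disc around \<open>z1\<close> to lie in the disc of radius \<open>\<rho> / 4\<close>, on which all functions
      below are defined\<close>
  define \<epsilon> where "\<epsilon> = min \<delta> (\<rho> / 4 - cmod z1)"
  have \<epsilon>: "0 < \<epsilon>" "\<epsilon> \<le> \<delta>" "\<epsilon> \<le> \<rho> / 4 - cmod z1" using z1 \<open>0 < \<delta>\<close> by (auto simp: \<epsilon>_def)
  have sub: "ball z1 \<epsilon> \<subseteq> ball 0 (\<rho> / 4)"
  proof
    fix w assume "w \<in> ball z1 \<epsilon>"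
    then show "w \<in> ball 0 (\<rho> / 4)"
      using norm_triangle_ineq[of z1 "w - z1"] \<epsilon> by (simp add: dist_norm norm_minus_commute)
  qed
  have line: "complex_of_real (Re z1) + \<i> * of_real y \<in> ball z1 \<epsilon>" if "\<bar>y - Im z1\<bar> < \<epsilon>" for y
  proof -
    have "z1 - (complex_of_real (Re z1) + \<i> * of_real y) = \<i> * of_real (Im z1 - y)"
      by (simp add: complex_eq_iff)
    then show ?thesis using that by (simp add: dist_norm norm_mult del: of_real_diff)
  qed
  have y_small: "\<bar>y\<bar> < \<rho> / 4" if "\<bar>y - Im z1\<bar> < \<epsilon>" for y
    using that \<epsilon> abs_Im_le_cmod[of z1] by linarith
  have \<Phi>_f: "\<Phi> y w = f w" if y: "\<bar>y - Im z1\<bar> < \<epsilon>" and w: "w \<in> ball z1 \<epsilon>" for y w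
  proof -
    let ?p = "complex_of_real (Re z1) + \<i> * of_real y"
    have "\<Phi> y w - f w = 0"
    proof (rule analytic_continuation[where S = "ball z1 \<epsilon>" and U = "{w \<in> ball z1 \<epsilon>. Im w = y}"
          and \<xi> = ?p and f = "\<lambda>w. \<Phi> y w - f w"])
      have "\<Phi> y holomorphic_on ball z1 \<epsilon>"
      proof (rule holomorphic_on_subset[OF \<Phi>_holo])
        show "\<bar>y\<bar> < \<rho> / 2" using y_small[OF y] by linarith
        show "ball z1 \<epsilon> \<subseteq> ball 0 (\<rho> / 2)" using sub \<open>0 < \<rho>\<close> by force
      qed
      moreover have "f holomorphic_on ball z1 \<epsilon>"
        using \<epsilon> by (intro holomorphic_on_subset[OF holo]) auto
      ultimately show "(\<lambda>w. \<Phi> y w - f w) holomorphic_on ball z1 \<epsilon>" by (rule holomorphic_on_diff)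
      show "?p \<in> ball z1 \<epsilon>" using line[OF y] .
      obtain d where d: "0 < d" "ball ?p d \<subseteq> ball z1 \<epsilon>"
        using line[OF y] open_ball[of z1 \<epsilon>] by (meson open_contains_ball)
      have "?p + of_real t \<in> {w \<in> ball z1 \<epsilon>. Im w = y}" if "0 < t" "t < d" for t
      proof -
        have "?p + of_real t \<in> ball ?p d" using that by (simp add: dist_norm)
        then show ?thesis using d by auto
      qed
      then show "?p islimpt {w \<in> ball z1 \<epsilon>. Im w = y}" using d by (intro islimpt_real_direction[of d])
      fix w assume w: "w \<in> {w \<in> ball z1 \<epsilon>. Im w = y}"
      then have "w - \<i> * of_real y = of_real (Re w)" by (auto simp: complex_eq_iff)
      moreover have "cmod w < \<rho>" using w sub \<open>0 < \<rho>\<close> by force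
      ultimately show "\<Phi> y w - f w = 0" using w by (simp add: \<Phi>_def fF)
    qed (use w in auto)
    then show ?thesis by simp
  qed
  define \<Psi> where "\<Psi> = \<Phi> (Im z1)"
  have \<Psi>_holo: "\<Psi> holomorphic_on ball 0 (\<rho> / 2)"
    unfolding \<Psi>_def using y_small[of "Im z1"] \<epsilon> \<open>0 < \<rho>\<close> by (intro \<Phi>_holo) auto
  have \<Phi>_\<Psi>: "\<Phi> y w = \<Psi> w" if y: "\<bar>y - Im z1\<bar> < \<epsilon>" and w: "w \<in> ball 0 (\<rho> / 2)" for y w
  proof (rule analytic_continuation_open[where s = "ball z1 \<epsilon>" and s' = "ball 0 (\<rho> / 2)"
        and f = "\<Phi> y" and g = \<Psi>])
    show "ball z1 \<epsilon> \<subseteq> ball 0 (\<rho> / 2)" using sub \<open>0 < \<rho>\<close> by force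
    show "\<Phi> y holomorphic_on ball 0 (\<rho> / 2)" using y_small[OF y] by (intro \<Phi>_holo) auto
    show "\<Phi> y z = \<Psi> z" if "z \<in> ball z1 \<epsilon>" for z
      using \<Phi>_f[OF y that] \<Phi>_f[OF _ that, of "Im z1"] \<epsilon> by (simp add: \<Psi>_def)
  qed (use \<epsilon> w \<Psi>_holo in auto)
  have inside: "X + \<i> * Y \<in> ball 0 (\<rho> / 2)" if "cmod X < \<rho> / 4" "cmod Y < \<rho> / 4" for X Y
    using norm_triangle_ineq[of X "\<i> * Y"] that by (simp add: norm_mult)
  have F_\<Psi>: "F X Y = \<Psi> (X + \<i> * Y)" if X: "cmod X < \<rho> / 4" and Y: "cmod Y < \<rho> / 4" for X Y
  proof -
    have "F X Y - \<Psi> (X + \<i> * Y) = 0"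
    proof (rule analytic_continuation[where S = "ball 0 (\<rho> / 4)" and \<xi> = "of_real (Im z1)"
          and U = "{of_real y | y. \<bar>y - Im z1\<bar> < \<epsilon>}" and f = "\<lambda>Y. F X Y - \<Psi> (X + \<i> * Y)"])
      have "F X holomorphic_on ball 0 (\<rho> / 4)"
        using X \<open>0 < \<rho>\<close> by (intro holomorphic_on_subset[OF FY]) auto
      moreover have "(\<Psi> \<circ> (\<lambda>Y. X + \<i> * Y)) holomorphic_on ball 0 (\<rho> / 4)"
        using inside X
        by (intro holomorphic_on_compose_gen[OF _ \<Psi>_holo] holomorphic_intros) auto
      ultimately show "(\<lambda>Y. F X Y - \<Psi> (X + \<i> * Y)) holomorphic_on ball 0 (\<rho> / 4)"
        by (intro holomorphic_on_diff) (simp_all add: o_def)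
      show "{complex_of_real y | y. \<bar>y - Im z1\<bar> < \<epsilon>} \<subseteq> ball 0 (\<rho> / 4)"
        using y_small by auto
      show "complex_of_real (Im z1) \<in> ball 0 (\<rho> / 4)" using y_small[of "Im z1"] \<epsilon> by auto
      show "complex_of_real (Im z1) islimpt {of_real y | y. \<bar>y - Im z1\<bar> < \<epsilon>}"
      proof (rule islimpt_real_direction[of \<epsilon>])
        show "complex_of_real (Im z1) + of_real t \<in> {of_real y | y. \<bar>y - Im z1\<bar> < \<epsilon>}"
          if "0 < t" "t < \<epsilon>" for t
          using that by (intro CollectI exI[of _ "Im z1 + t"]) auto
      qed (use \<epsilon> in auto)
      fix Y assume "Y \<in> {complex_of_real y | y. \<bar>y - Im z1\<bar> < \<epsilon>}"
      then obtain y where y: "Y = of_real y" "\<bar>y - Im z1\<bar> < \<epsilon>" by blast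
      have "cmod Y < \<rho> / 4" using y y_small by auto
      then have "\<Phi> y (X + \<i> * Y) = \<Psi> (X + \<i> * Y)"
        using X y by (intro \<Phi>_\<Psi> inside) auto
      then show "F X Y - \<Psi> (X + \<i> * Y) = 0" using y by (simp add: \<Phi>_def)
    qed (use Y in auto)
    then show ?thesis by simp
  qed
  have "f z = \<Psi> z" if "z \<in> ball 0 (\<rho> / 4)" for z
  proof -
    have z: "cmod z < \<rho> / 4" using that by simp
    have "f z = F (of_real (Re z)) (of_real (Im z))" using z \<open>0 < \<rho>\<close> by (intro fF) auto
    also have "\<dots> = \<Psi> (of_real (Re z) + \<i> * of_real (Im z))"
      using z abs_Re_le_cmod[of z] abs_Im_le_cmod[of z] by (intro F_\<Psi>) auto
    finally show ?thesis by (simp add: complex_eq[symmetric])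
  qed
  moreover have "\<Psi> holomorphic_on ball 0 (\<rho> / 4)"
    using \<open>0 < \<rho>\<close> by (intro holomorphic_on_subset[OF \<Psi>_holo]) auto
  ultimately show ?thesis using holomorphic_cong by metis
qed

lemma real_analytic_holomorphic_spreads:
  assumes "real_analytic f S" "z0 \<in> S"
  obtains d where "0 < d" and
    "\<And>z1 \<delta>. z1 \<in> ball z0 d \<Longrightarrow> 0 < \<delta> \<Longrightarrow> f holomorphic_on ball z1 \<delta> \<Longrightarrow> f holomorphic_on ball z0 d"
proof -
  from assms obtain r c where "0 < r" and c: "\<And>z. z \<in> ball z0 r \<Longrightarrow>
     ((\<lambda>(m, n). c m n * complex_of_real (Re (z - z0) ^ m * Im (z - z0) ^ n)) has_sum f z) UNIV"
    unfolding real_analytic_def by blast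
  have shift: "(\<lambda>w. z0 + w) ` ball a e = ball (z0 + a) e" for a :: complex and e
    using image_add_ball[of z0 a e] by (simp add: add.commute[of a])
  show ?thesis
  proof
    show "0 < r / 8" using \<open>0 < r\<close> by simp
    fix z1 \<delta>
    assume z1: "z1 \<in> ball z0 (r / 8)" and "0 < \<delta>" and holo: "f holomorphic_on ball z1 \<delta>"
    have "(f \<circ> (\<lambda>w. z0 + w)) holomorphic_on ball 0 ((r / 2) / 4)"
    proof (rule real_analytic_holomorphic_spreads_at_0[of "r / 2" c _ "z1 - z0" \<delta>])
      show "((\<lambda>(m, n). c m n * complex_of_real (Re z ^ m * Im z ^ n)) has_sum (f \<circ> (+) z0) z) UNIV"
        if "cmod z < 2 * (r / 2)" for z
        using c[of "z0 + z"] that by (simp add: dist_norm)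
      show "(f \<circ> (+) z0) holomorphic_on ball (z1 - z0) \<delta>"
        using holo by (intro holomorphic_on_compose holomorphic_intros) (simp add: shift)
    qed (use z1 \<open>0 < r\<close> \<open>0 < \<delta>\<close> in \<open>auto simp: dist_norm norm_minus_commute\<close>)
    then have "((f \<circ> (\<lambda>w. z0 + w)) \<circ> (\<lambda>z. z - z0)) holomorphic_on ball z0 (r / 8)"
      by (rule holomorphic_on_compose_gen[rotated])
        (auto intro!: holomorphic_intros simp: dist_norm norm_minus_commute)
    then show "f holomorphic_on ball z0 (r / 8)" by (simp add: o_def)
  qed
qed

text \<open>
  The set of points near which \<open>f\<close> is holomorphic is open, and by the preceding lemma it is also closed
  in \<open>S\<close>.
\<close>

lemma real_analytic_holomorphic_continuation:
  assumes "real_analytic f S" "connected S" "open S" "z1 \<in> S" "0 < \<delta>" "f holomorphic_on ball z1 \<delta>"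
  shows "f holomorphic_on S"
proof -
  have "\<exists>e>0. f holomorphic_on ball z e" if "z \<in> S" for z
  proof (rule connected_induction_simple[OF \<open>connected S\<close> \<open>z1 \<in> S\<close> that])
    show "\<exists>e>0. f holomorphic_on ball z1 e" using assms by blast
    fix a assume "a \<in> S"
    from real_analytic_holomorphic_spreads[OF assms(1) this] obtain d where d: "0 < d"
      "\<And>z1 \<delta>. z1 \<in> ball a d \<Longrightarrow> 0 < \<delta> \<Longrightarrow> f holomorphic_on ball z1 \<delta> \<Longrightarrow> f holomorphic_on ball a d"
      by blast
    show "\<exists>T. openin (top_of_set S) T \<and> a \<in> T \<and> (\<forall>x\<in>T. \<forall>y\<in>T.
        (\<exists>e>0. f holomorphic_on ball x e) \<longrightarrow> (\<exists>e>0. f holomorphic_on ball y e))"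
    proof (intro exI[of _ "S \<inter> ball a d"] conjI ballI impI)
      show "openin (top_of_set S) (S \<inter> ball a d)" by (simp add: openin_open_Int)
      show "a \<in> S \<inter> ball a d" using \<open>a \<in> S\<close> d by simp
      fix x y assume x: "x \<in> S \<inter> ball a d" and y: "y \<in> S \<inter> ball a d"
        and "\<exists>e>0. f holomorphic_on ball x e"
      then have holo: "f holomorphic_on ball a d" using d by blast
      obtain e where "0 < e" "ball y e \<subseteq> ball a d"
        using y open_ball[of a d] by (meson IntD2 open_contains_ball)
      then show "\<exists>e>0. f holomorphic_on ball y e"
        using holo holomorphic_on_subset by blast
    qed
  qed
  then have "f analytic_on S" by (simp add: analytic_on_def)
  then show ?thesis by (rule analytic_imp_holomorphic)
qed

section \<open>Convergent expansions and their uniqueness\<close>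

text \<open>
  Convergence is recorded through the values alone, which makes closure under linear combinations
  immediate; summability in \<open>\<complex>\<close> is absolute.
\<close>

definition conv_expansion :: "(complex \<Rightarrow> complex) \<Rightarrow> complex coeffs \<Rightarrow> bool" where
  "conv_expansion g a \<longleftrightarrow> a \<in> laurent_series \<and>
     (\<exists>\<epsilon>>0. \<forall>z. 0 < cmod z \<and> cmod z < \<epsilon> \<longrightarrow> ((\<lambda>(s, t). a s t * zpow z s t) has_sum g z) UNIV)"

lemma expands_as_imp_conv_expansion: "expands_as g a \<Longrightarrow> conv_expansion g a"
  by (simp add: expands_as_def conv_expansion_def)

lemma laurent_series_add:
  assumes "a \<in> laurent_series" "b \<in> laurent_series"
  shows "(\<lambda>s t. a s t + b s t :: 'w :: ab_group_add) \<in> laurent_series"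
proof -
  obtain N where N: "\<And>s t. s \<le> N \<or> t \<le> N \<Longrightarrow> a s t = 0"
    using assms(1) unfolding laurent_series_def by blast
  obtain M where M: "\<And>s t. s \<le> M \<or> t \<le> M \<Longrightarrow> b s t = 0"
    using assms(2) unfolding laurent_series_def by blast
  have "(\<lambda>s t. a s t + b s t) \<in> formal_series"
    using assms unfolding laurent_series_def formal_series_def by auto (metis add_0)
  moreover have "\<forall>s t. s \<le> min N M \<or> t \<le> min N M \<longrightarrow> a s t + b s t = 0"
    using N M by auto
  moreover have "finite {(s, t). a s t + b s t \<noteq> 0 \<and> s + t \<le> R}" for R
    by (rule finite_subset[of _ "{(s, t). a s t \<noteq> 0 \<and> s + t \<le> R} \<union> {(s, t). b s t \<noteq> 0 \<and> s + t \<le> R}"])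
      (use assms in \<open>simp_all add: laurent_series_def, auto\<close>)
  ultimately show ?thesis unfolding laurent_series_def by blast
qed

lemma laurent_series_scale:
  assumes "a \<in> laurent_series"
  shows "(\<lambda>s t. c * a s t :: complex) \<in> laurent_series"
proof -
  obtain N where N: "\<And>s t. s \<le> N \<or> t \<le> N \<Longrightarrow> a s t = 0"
    using assms(1) unfolding laurent_series_def by blast
  have "(\<lambda>s t. c * a s t) \<in> formal_series"
    using assms unfolding laurent_series_def formal_series_def by auto
  moreover have "\<forall>s t. s \<le> N \<or> t \<le> N \<longrightarrow> c * a s t = 0"
    using N by auto
  moreover have "finite {(s, t). c * a s t \<noteq> 0 \<and> s + t \<le> R}" for R
    by (rule finite_subset[of _ "{(s, t). a s t \<noteq> 0 \<and> s + t \<le> R}"])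
      (use assms in \<open>simp_all add: laurent_series_def, auto\<close>)
  ultimately show ?thesis unfolding laurent_series_def by blast
qed

lemma conv_expansion_zero: "conv_expansion (\<lambda>_. 0) (\<lambda>_ _. 0)"
  by (auto simp: conv_expansion_def laurent_series_def formal_series_def case_prod_unfold
      intro!: exI[of _ 1])

lemma conv_expansion_add:
  assumes "conv_expansion f a" "conv_expansion g b"
  shows "conv_expansion (\<lambda>z. f z + g z) (\<lambda>s t. a s t + b s t)"
proof -
  obtain d where "0 < d" and d: "\<And>z. 0 < cmod z \<Longrightarrow> cmod z < d \<Longrightarrow>
      ((\<lambda>(s, t). a s t * zpow z s t) has_sum f z) UNIV"
    using assms(1) unfolding conv_expansion_def by blast
  obtain e where "0 < e" and e: "\<And>z. 0 < cmod z \<Longrightarrow> cmod z < e \<Longrightarrow>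
      ((\<lambda>(s, t). b s t * zpow z s t) has_sum g z) UNIV"
    using assms(2) unfolding conv_expansion_def by blast
  have "((\<lambda>(s, t). (a s t + b s t) * zpow z s t) has_sum f z + g z) UNIV"
    if "0 < cmod z" "cmod z < min d e" for z
    using has_sum_add[OF d[of z] e[of z]] that by (simp add: case_prod_unfold ring_distribs)
  moreover have "0 < min d e" using \<open>0 < d\<close> \<open>0 < e\<close> by simp
  ultimately show ?thesis
    using assms laurent_series_add unfolding conv_expansion_def by blast
qed

lemma conv_expansion_scale:
  assumes "conv_expansion f a"
  shows "conv_expansion (\<lambda>z. c * f z) (\<lambda>s t. c * a s t)"
proof -
  obtain d where "0 < d" and d: "\<And>z. 0 < cmod z \<Longrightarrow> cmod z < d \<Longrightarrow>
      ((\<lambda>(s, t). a s t * zpow z s t) has_sum f z) UNIV"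
    using assms(1) unfolding conv_expansion_def by blast
  have "((\<lambda>(s, t). (c * a s t) * zpow z s t) has_sum c * f z) UNIV"
    if "0 < cmod z" "cmod z < d" for z
    using has_sum_cmult_right[OF d[of z], of c] that by (simp add: case_prod_unfold mult_ac)
  then show ?thesis
    using assms laurent_series_scale \<open>0 < d\<close> unfolding conv_expansion_def by blast
qed

lemma has_sum_reindex_support:
  assumes "(f has_sum S) UNIV" "inj h" "\<And>x. f x \<noteq> 0 \<Longrightarrow> x \<in> range h"
  shows "((\<lambda>i. f (h i)) has_sum S) UNIV"
proof -
  have "(f has_sum S) (range h) \<longleftrightarrow> (f has_sum S) UNIV"
    by (rule has_sum_cong_neutral) (use assms(3) in auto)
  then show ?thesis using assms has_sum_reindex[of h UNIV f S] by (simp add: o_def)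
qed

lemma laurent_series_int_bound:
  assumes "a \<in> laurent_series"
  obtains N :: int where "\<And>s t. a s t \<noteq> 0 \<Longrightarrow> of_int N < s \<and> of_int N < t"
proof -
  obtain N :: real where N: "\<And>s t. s \<le> N \<or> t \<le> N \<Longrightarrow> a s t = 0"
    using assms(1) unfolding laurent_series_def by blast
  have "of_int \<lfloor>N\<rfloor> < s \<and> of_int \<lfloor>N\<rfloor> < t" if "a s t \<noteq> 0" for s t
    using N[of s t] that by linarith
  then show ?thesis by (rule that)
qed

lemma zpow_of_int_0: "zpow z (of_int n) 0 = (if z = 0 then 0 else z powi n)"
  by (simp add: zpow_def)

text \<open>
  With exponents \<open>(n, 0)\<close> only, \<open>n\<close> integral and bounded below, the formal series is a
  Laurent series in \<open>z\<close>.
\<close>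

lemma conv_expansion_imp_has_laurent_expansion:
  assumes "conv_expansion g a" and supp: "\<And>s t. a s t \<noteq> 0 \<Longrightarrow> t = 0 \<and> s \<in> \<int>"
  obtains F where "g has_laurent_expansion F" "\<And>n. fls_nth F n = a (of_int n) 0"
proof -
  obtain N :: int where N: "\<And>s t. a s t \<noteq> 0 \<Longrightarrow> of_int N < s \<and> of_int N < t"
    using laurent_series_int_bound assms(1) unfolding conv_expansion_def by metis
  obtain \<epsilon> where "0 < \<epsilon>" and \<epsilon>: "\<And>z. 0 < cmod z \<Longrightarrow> cmod z < \<epsilon> \<Longrightarrow>
      ((\<lambda>(s, t). a s t * zpow z s t) has_sum g z) UNIV"
    using assms(1) unfolding conv_expansion_def by blast
  define c where "c k = a (of_int (N + int k)) 0" for k :: nat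
  have sums: "(\<lambda>k. c k * z ^ k) sums (z powi (- N) * g z)" if z: "0 < cmod z" "cmod z < \<epsilon>" for z
  proof -
    let ?h = "\<lambda>k::nat. (real_of_int (N + int k), 0::real)"
    have "((\<lambda>k. case ?h k of (s, t) \<Rightarrow> a s t * zpow z s t) has_sum g z) UNIV"
    proof (rule has_sum_reindex_support[OF \<epsilon>[OF z]])
      show "inj ?h" by (auto simp: inj_on_def)
      fix x assume nz: "(case x of (s, t) \<Rightarrow> a s t * zpow z s t) \<noteq> 0"
      obtain s t where x: "x = (s, t)" by (cases x)
      then have "t = 0" "s \<in> \<int>" "of_int N < s" using supp[of s t] N[of s t] nz by auto
      then obtain m where m: "s = of_int m" "N < m" by (auto elim!: Ints_cases)
      then show "x \<in> range ?h"
        using x \<open>t = 0\<close> by (intro image_eqI[of _ _ "nat (m - N)"]) auto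
    qed
    then have "((\<lambda>k. c k * z powi (N + int k)) has_sum g z) UNIV"
      using z unfolding c_def by (simp add: zpow_of_int_0 del: of_int_add)
    then have "((\<lambda>k. z powi (- N) * (c k * z powi (N + int k))) has_sum z powi (- N) * g z) UNIV"
      by (rule has_sum_cmult_right)
    moreover have "z powi (- N) * (c k * z powi (N + int k)) = c k * z ^ k" for k
      using z by (simp add: power_int_add power_int_minus)
    ultimately show ?thesis by (intro has_sum_imp_sums) simp
  qed
  define f where "f z = suminf (\<lambda>k. c k * z ^ k)" for z
  have "f has_fps_expansion Abs_fps c"
  proof (rule has_fps_expansionI)
    have "eventually (\<lambda>u. u \<in> ball 0 \<epsilon>) (nhds (0 :: complex))"
      using \<open>0 < \<epsilon>\<close> by (intro eventually_nhds_in_open) auto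
    then show "eventually (\<lambda>u. (\<lambda>n. fps_nth (Abs_fps c) n * u ^ n) sums f u) (nhds 0)"
    proof eventually_elim
      case (elim u)
      have "summable (\<lambda>k. c k * u ^ k)"
        using sums[of u] elim by (cases "u = 0") (auto simp: sums_iff)
      then show ?case by (simp add: f_def summable_sums)
    qed
  qed
  then have "(\<lambda>z. f z * z powi N) has_laurent_expansion fls_shift (- N) (fps_to_fls (Abs_fps c))"
    by (intro has_laurent_expansion_shift has_laurent_expansion_fps)
  moreover have "eventually (\<lambda>z. f z * z powi N = g z) (at 0)"
  proof -
    have "eventually (\<lambda>u. u \<in> ball 0 \<epsilon> - {0}) (at (0 :: complex))"
      using \<open>0 < \<epsilon>\<close> by (intro eventually_at_in_open) auto
    then show ?thesis
    proof eventually_elim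
      case (elim z)
      then have "f z = z powi (- N) * g z"
        using sums[of z] by (auto simp: f_def sums_iff)
      then show ?case using elim by (auto simp: power_int_minus)
    qed
  qed
  ultimately have "g has_laurent_expansion fls_shift (- N) (fps_to_fls (Abs_fps c))"
    by (subst has_laurent_expansion_cong[OF _ refl, symmetric])
  moreover have "fls_nth (fls_shift (- N) (fps_to_fls (Abs_fps c))) n = a (of_int n) 0" for n
    using N[of "of_int n" 0] by (cases "a (of_int n) 0 = 0") (auto simp: c_def)
  ultimately show ?thesis by (rule that)
qed

lemma power_series_zero_on_reals:
  fixes c :: "nat \<Rightarrow> complex"
  assumes "0 < \<epsilon>" and sums: "\<And>r. 0 < r \<Longrightarrow> r < \<epsilon> \<Longrightarrow> (\<lambda>k. c k * of_real r ^ k) sums 0"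
  shows "c k = 0"
proof -
  define f where "f z = suminf (\<lambda>k. c k * z ^ k)" for z
  have f: "f has_fps_expansion Abs_fps c"
  proof (rule has_fps_expansionI)
    have "eventually (\<lambda>u. u \<in> ball 0 (\<epsilon> / 2)) (nhds (0 :: complex))"
      using \<open>0 < \<epsilon>\<close> by (intro eventually_nhds_in_open) auto
    then show "eventually (\<lambda>u. (\<lambda>n. fps_nth (Abs_fps c) n * u ^ n) sums f u) (nhds 0)"
    proof eventually_elim
      case (elim u)
      have "summable (\<lambda>k. c k * complex_of_real (\<epsilon> / 2) ^ k)"
        using \<open>0 < \<epsilon>\<close> by (intro sums_summable[OF sums]) auto
      then have "summable (\<lambda>k. c k * u ^ k)"
        by (rule powser_inside) (use elim \<open>0 < \<epsilon>\<close> in simp)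
      then show ?case by (simp add: f_def summable_sums)
    qed
  qed
  have "Abs_fps c = 0"
  proof (rule ccontr)
    assume "Abs_fps c \<noteq> 0"
    then have "eventually (\<lambda>z. f z \<noteq> 0) (at 0)"
      using has_laurent_expansion_nonzero_imp_eventually_nonzero[of f "fps_to_fls (Abs_fps c)"]
        has_laurent_expansion_fps[OF f] by simp
    then obtain d where "0 < d" and d: "\<And>z. z \<noteq> 0 \<Longrightarrow> cmod z < d \<Longrightarrow> f z \<noteq> 0"
      unfolding eventually_at by auto
    define r where "r = min d \<epsilon> / 2"
    have r: "0 < r" "r < d" "r < \<epsilon>" using \<open>0 < d\<close> \<open>0 < \<epsilon>\<close> by (auto simp: r_def)
    then have "f (of_real r) = 0" using sums[of r] by (auto simp: f_def sums_iff)
    with d[of "of_real r"] r show False by auto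
  qed
  then have "fps_nth (Abs_fps c) k = 0" by simp
  then show ?thesis by simp
qed

text \<open>
  On the circle \<open>z = r \<zeta>\<close>, \<open>\<bar>\<zeta>\<bar> = 1\<close>, the series is up to a power of \<open>r\<close> a power series in \<open>r\<close>.
  Its coefficients, the sums over the terms of a fixed total degree, therefore vanish, and they are
  up to a power of \<open>\<zeta>\<close> polynomials in \<open>\<zeta>\<^sup>2\<close> with infinitely many roots.
\<close>

lemma conv_expansion_zero_unique:
  assumes conv: "conv_expansion g a" and "0 < \<delta>"
    and g0: "\<And>z. 0 < cmod z \<Longrightarrow> cmod z < \<delta> \<Longrightarrow> g z = 0"
    and supp: "\<And>s t. a s t \<noteq> 0 \<Longrightarrow> s \<in> \<int> \<and> t \<in> \<int>"
  shows "a s t = 0"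
proof -
  obtain N :: int where N: "\<And>s t. a s t \<noteq> 0 \<Longrightarrow> of_int N < s \<and> of_int N < t"
    using laurent_series_int_bound conv unfolding conv_expansion_def by metis
  obtain \<epsilon>0 where "0 < \<epsilon>0" and \<epsilon>0: "\<And>z. 0 < cmod z \<Longrightarrow> cmod z < \<epsilon>0 \<Longrightarrow>
      ((\<lambda>(s, t). a s t * zpow z s t) has_sum g z) UNIV"
    using conv unfolding conv_expansion_def by blast
  define \<epsilon> where "\<epsilon> = min \<delta> \<epsilon>0"
  have "0 < \<epsilon>" using \<open>0 < \<delta>\<close> \<open>0 < \<epsilon>0\<close> by (simp add: \<epsilon>_def)
  define b where "b i j = a (of_int (N + int i)) (of_int (N + int j))" for i j
  have double: "((\<lambda>(i, j). b i j * \<zeta> powi (int i - int j) * of_real r ^ (i + j)) has_sum 0) UNIV"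
    if \<zeta>: "cmod \<zeta> = 1" and r: "0 < r" "r < \<epsilon>" for \<zeta> r
  proof -
    define z where "z = of_real r * \<zeta>"
    have z: "cmod z = r" "z \<noteq> 0" using \<zeta> r by (auto simp: z_def norm_mult)
    let ?h = "\<lambda>(i :: nat, j :: nat). (real_of_int (N + int i), real_of_int (N + int j))"
    have "((\<lambda>(s, t). a s t * zpow z s t) has_sum 0) UNIV"
      using \<epsilon>0[of z] g0[of z] z r by (simp add: \<epsilon>_def)
    then have "((\<lambda>p. case ?h p of (s, t) \<Rightarrow> a s t * zpow z s t) has_sum 0) UNIV"
    proof (rule has_sum_reindex_support)
      show "inj ?h" by (auto simp: inj_on_def)
      fix x assume nz: "(case x of (s, t) \<Rightarrow> a s t * zpow z s t) \<noteq> 0"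
      obtain s t where x: "x = (s, t)" by (cases x)
      then have "t \<in> \<int>" "s \<in> \<int>" "of_int N < s" "of_int N < t"
        using supp[of s t] N[of s t] nz by auto
      then obtain m n where "s = of_int m" "N < m" "t = of_int n" "N < n"
        by (auto elim!: Ints_cases)
      then show "x \<in> range ?h"
        using x by (intro image_eqI[of _ _ "(nat (m - N), nat (n - N))"]) auto
    qed
    then have "((\<lambda>(i, j). b i j * zpow z (of_int (N + int i)) (of_int (N + int j))) has_sum 0) UNIV"
      by (simp add: b_def case_prod_unfold)
    moreover have "zpow z (of_int (N + int i)) (of_int (N + int j)) =
        of_real r powi (2 * N) * (\<zeta> powi (int i - int j) * of_real r ^ (i + j))" for i j
    proof -
      have "real_of_int (N + int i) - real_of_int (N + int j) = of_int (int i - int j)" by simp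
      then have "zpow z (of_int (N + int i)) (of_int (N + int j)) =
          z powi (int i - int j) * complex_of_real ((r ^ 2) powr of_int (N + int j))"
        unfolding zpow_def z(1) by (simp only: floor_of_int)
      also have "(r ^ 2) powr of_int (N + int j) = r powi (2 * (N + int j))"
        using r powr_real_of_int'[of "r ^ 2" "N + int j"] power_int_mult[of r 2 "N + int j"]
        by (simp del: of_int_add)
      also have "complex_of_real \<dots> = of_real r powi (2 * (N + int j))" by simp
      also have "z powi (int i - int j) = of_real r powi (int i - int j) * \<zeta> powi (int i - int j)"
        by (simp add: z_def power_int_mult_distrib)
      also have "of_real r powi (int i - int j) * \<zeta> powi (int i - int j) * of_real r powi (2 * (N + int j))
          = (of_real r powi (int i - int j) * of_real r powi (2 * (N + int j))) * \<zeta> powi (int i - int j)"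
        by (simp add: mult_ac)
      also have "complex_of_real r powi (int i - int j) * of_real r powi (2 * (N + int j)) =
          of_real r powi ((int i - int j) + 2 * (N + int j))"
        using r by (subst power_int_add) auto
      also have "(int i - int j) + 2 * (N + int j) = 2 * N + int (i + j)" by simp
      also have "complex_of_real r powi \<dots> = of_real r powi (2 * N) * of_real r ^ (i + j)"
        using r power_int_add[of "complex_of_real r" "2 * N" "int (i + j)"]
        by (simp only: power_int_of_nat) simp
      finally show ?thesis by (simp add: mult_ac)
    qed
    ultimately have "((\<lambda>(i, j). of_real r powi (2 * N) *
        (b i j * \<zeta> powi (int i - int j) * of_real r ^ (i + j))) has_sum 0) UNIV"
      by (simp add: mult_ac)
    then show ?thesis
      using r has_sum_cmult_right_iff[of "complex_of_real r powi (2 * N)"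
          "\<lambda>(i, j). b i j * \<zeta> powi (int i - int j) * of_real r ^ (i + j)" UNIV 0]
      by (simp add: case_prod_unfold)
  qed
  have degree: "(\<Sum>i\<le>k. b i (k - i) * \<zeta> powi (int i - int (k - i))) = 0" if \<zeta>: "cmod \<zeta> = 1" for k \<zeta>
  proof (rule power_series_zero_on_reals[OF \<open>0 < \<epsilon>\<close>])
    fix r assume r: "0 < r" "r < \<epsilon>"
    let ?f = "\<lambda>i j. b i j * \<zeta> powi (int i - int j) * of_real r ^ (i + j)"
    have "((\<lambda>(k, i). ?f i (k - i)) has_sum 0) (Sigma UNIV (\<lambda>k. {..k}))"
    proof (subst has_sum_reindex_bij_witness[where T = UNIV and h = "\<lambda>(i, j). ?f i j"
          and i = "\<lambda>(i, j). (i + j, i)" and j = "\<lambda>(k, i). (i, k - i)"])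
      show "((\<lambda>(i, j). ?f i j) has_sum 0) UNIV" by (rule double[OF \<zeta> r])
    qed auto
    then have "((\<lambda>k. (\<Sum>i\<le>k. ?f i (k - i))) has_sum 0) UNIV"
      by (rule has_sum_SigmaD) (simp add: has_sum_finite_iff)
    then have "(\<lambda>k. \<Sum>i\<le>k. ?f i (k - i)) sums 0" by (rule has_sum_imp_sums)
    moreover have "(\<Sum>i\<le>k. ?f i (k - i)) =
        (\<Sum>i\<le>k. b i (k - i) * \<zeta> powi (int i - int (k - i))) * of_real r ^ k" for k
      unfolding sum_distrib_right by (intro sum.cong) auto
    ultimately show "(\<lambda>k. (\<Sum>i\<le>k. b i (k - i) * \<zeta> powi (int i - int (k - i))) * of_real r ^ k) sums 0"
      by simp
  qed
  have b0: "b i j = 0" for i j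
  proof -
    let ?k = "i + j"
    have "(\<Sum>i\<le>?k. b i (?k - i) * \<eta> ^ i) = 0" if \<eta>: "cmod \<eta> = 1" for \<eta>
    proof -
      \<comment> \<open>multiplied by \<open>\<zeta>^(i + j)\<close>, the sum of the terms of degree \<open>i + j\<close> only contains even powers of \<open>\<zeta>\<close>\<close>
      define \<zeta> where "\<zeta> = csqrt \<eta>"
      have \<zeta>: "cmod \<zeta> = 1" "\<zeta> ^ 2 = \<eta>" "\<zeta> \<noteq> 0" using \<eta> by (auto simp: \<zeta>_def norm_csqrt)
      have "0 = (\<Sum>i\<le>?k. b i (?k - i) * \<zeta> powi (int i - int (?k - i))) * \<zeta> ^ ?k"
        using degree[OF \<zeta>(1), of ?k] by simp
      also have "\<dots> = (\<Sum>i\<le>?k. b i (?k - i) * \<eta> ^ i)"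
        unfolding sum_distrib_right
      proof (intro sum.cong refl)
        fix l assume "l \<in> {..?k}"
        then have "int l - int (?k - l) + int ?k = int (2 * l)" by auto
        then have "\<zeta> powi (int l - int (?k - l)) * \<zeta> ^ ?k = \<zeta> ^ (2 * l)"
          using power_int_add[of \<zeta> "int l - int (?k - l)" "int ?k"] \<zeta>(3) by (simp only: power_int_of_nat) auto
        then show "b l (?k - l) * \<zeta> powi (int l - int (?k - l)) * \<zeta> ^ ?k = b l (?k - l) * \<eta> ^ l"
          using \<zeta>(2) by (simp add: power_mult mult.assoc)
      qed
      finally show ?thesis by simp
    qed
    then have "sphere 0 1 \<subseteq> {\<eta>. (\<Sum>i\<le>?k. b i (?k - i) * \<eta> ^ i) = 0}" by auto
    moreover have "infinite (sphere (0 :: complex) 1)"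
    proof
      assume "finite (sphere (0 :: complex) 1)"
      then have "\<exists>a. sphere (0 :: complex) 1 = {a}"
        using connected_finite_iff_sing[of "sphere (0 :: complex) 1"] connected_sphere[of "0 :: complex" 1]
        by auto
      moreover have "1 \<in> sphere (0 :: complex) 1" "- 1 \<in> sphere (0 :: complex) 1" by auto
      ultimately show False by (metis singletonD one_neq_neg_one)
    qed
    ultimately have "infinite {\<eta>. (\<Sum>i\<le>?k. b i (?k - i) * \<eta> ^ i) = 0}"
      using finite_subset by blast
    then have "\<forall>l\<le>?k. b l (?k - l) = 0"
      using polyfun_finite_roots[of "\<lambda>l. b l (?k - l)" ?k] by auto
    from this[rule_format, of i] show ?thesis by simp
  qed
  show ?thesis
  proof (rule ccontr)
    assume nz: "a s t \<noteq> 0"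
    then obtain m n where mn: "s = of_int m" "t = of_int n" using supp by (metis Ints_cases)
    then have "N < m" "N < n" using N[OF nz] by auto
    then have "a s t = b (nat (m - N)) (nat (n - N))" using mn by (simp add: b_def)
    then show False using nz b0 by simp
  qed
qed

section \<open>Residues on the sphere minus three points\<close>

text \<open>
  The coefficients of the product are those of a Cauchy product; stating them with
  \<^const>\<open>Sum_any\<close> matches the shape of the sums in the Borcherds identity.
\<close>

lemma has_laurent_expansion_binomial_times:
  assumes "g has_laurent_expansion F"
  obtains G where "(\<lambda>x. (1 + e * x) powi n * g x) has_laurent_expansion G"
    "\<And>k. fls_nth G k = Sum_any (\<lambda>i::nat. (of_int n gchoose i) * e ^ i * fls_nth F (k - int i))"
proof -
  define P where "P = fps_compose (fps_binomial (of_int n :: complex)) (fps_const e * fps_X)"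
  have P_nth: "fps_nth P i = (of_int n gchoose i) * e ^ i" for i
    by (simp add: P_def)
  have "((\<lambda>x. (1 + x) powr of_int n) \<circ> (\<lambda>x. e * x)) has_fps_expansion P"
    unfolding P_def by (intro has_fps_expansion_compose fps_expansion_intros) auto
  then have "(\<lambda>x. (1 + e * x) powr of_int n) has_laurent_expansion fps_to_fls P"
    by (auto intro: has_laurent_expansion_fps simp: o_def)
  moreover have "eventually (\<lambda>x. (1 + e * x) powr of_int n = (1 + e * x) powi n) (at 0)"
  proof -
    have "((\<lambda>x. 1 + e * x) \<longlongrightarrow> 1 + e * 0) (at 0)" by (intro tendsto_intros)
    then have "eventually (\<lambda>x. 1 + e * x \<in> - {0}) (at 0)"
      by (rule topological_tendstoD) auto
    then show ?thesis by eventually_elim (simp add: complex_powr_of_int)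
  qed
  ultimately have "(\<lambda>x. (1 + e * x) powi n) has_laurent_expansion fps_to_fls P"
    by (subst has_laurent_expansion_cong[OF _ refl, symmetric])
  from has_laurent_expansion_mult[OF this assms]
  have "(\<lambda>x. (1 + e * x) powi n * g x) has_laurent_expansion fps_to_fls P * F" .
  moreover have "fls_nth (fps_to_fls P * F) k =
      Sum_any (\<lambda>i::nat. (of_int n gchoose i) * e ^ i * fls_nth F (k - int i))" for k
  proof -
    let ?p = "fls_subdegree (fps_to_fls P)" and ?f = "fls_subdegree F"
    have p0: "0 \<le> ?p" by (rule fls_subdegree_fls_to_fps_gt0)
    have "Sum_any (\<lambda>i::nat. fps_nth P i * fls_nth F (k - int i)) =
        (\<Sum>i\<in>nat ` {?p..k - ?f}. fps_nth P i * fls_nth F (k - int i))"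
    proof (rule Sum_any.expand_superset)
      show "{i. fps_nth P i * fls_nth F (k - int i) \<noteq> 0} \<subseteq> nat ` {?p..k - ?f}"
      proof
        fix i assume "i \<in> {i. fps_nth P i * fls_nth F (k - int i) \<noteq> 0}"
        then have "fls_nth (fps_to_fls P) (int i) \<noteq> 0" "fls_nth F (k - int i) \<noteq> 0" by auto
        then have "?p \<le> int i" "?f \<le> k - int i"
          by (meson fls_eq0_below_subdegree not_le)+
        then show "i \<in> nat ` {?p..k - ?f}" by (intro image_eqI[of _ _ "int i"]) auto
      qed
    qed auto
    also have "\<dots> = (\<Sum>i\<in>{?p..k - ?f}. fps_nth P (nat i) * fls_nth F (k - i))"
      using p0 by (subst sum.reindex) (auto simp: inj_on_def intro!: sum.cong)
    also have "\<dots> = fls_nth (fps_to_fls P * F) k"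
      unfolding fls_times_nth(2) using p0 by (intro sum.cong) auto
    finally show ?thesis by (simp add: P_nth)
  qed
  ultimately show ?thesis by (rule that)
qed

text \<open>
  The substitution \<open>z = 1/w\<close> has \<open>dz = - dw / w\<^sup>2\<close>, and it reverses the orientation of the circle;
  the two signs cancel.
\<close>

lemma contour_integral_circlepath_inverse:
  assumes "0 < r" and I: "(f has_contour_integral I) (circlepath 0 r)"
  shows "((\<lambda>w. f (1 / w) / w ^ 2) has_contour_integral I) (circlepath 0 (1 / r))"
proof -
  have "((\<lambda>t. f (0 + r * cis t) * r * \<i> * cis t) has_integral I) (cbox 0 (2 * pi))"
    using I unfolding circlepath_def by (subst (asm) has_contour_integral_part_circlepath_iff) auto
  from has_integral_affinity[OF this, of "- 1" "2 * pi"]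
  have *: "((\<lambda>t. f (r * cis (2 * pi - t)) * r * \<i> * cis (2 * pi - t)) has_integral I)
      ((\<lambda>x. 2 * pi - x) ` {0..2 * pi})"
    by simp
  have img: "(\<lambda>x. 2 * pi - x) ` {0..2 * pi} = {0..2 * pi}"
    by (auto intro!: image_eqI[of _ _ "2 * pi - _"])
  have pt: "f (1 / (0 + complex_of_real (1 / r) * cis t)) / (0 + complex_of_real (1 / r) * cis t) ^ 2 * complex_of_real (1 / r) * \<i> * cis t
     = f (r * cis (2 * pi - t)) * r * \<i> * cis (2 * pi - t)" for t
  proof -
    have c: "cis (2 * pi - t) = inverse (cis t)"
      by (simp add: cis_divide[symmetric] inverse_eq_divide)
    show ?thesis using \<open>0 < r\<close> unfolding c by (simp add: field_simps power2_eq_square)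
  qed
  show ?thesis unfolding circlepath_def
    by (subst has_contour_integral_part_circlepath_iff) (use * img pt in auto)
qed

text \<open>
  The circle of radius 2 encloses both finite punctures; seen from infinity it is the circle of
  radius 1/2 in the coordinate \<open>1/z\<close>.
\<close>

theorem residue_theorem_three_points:
  assumes holo: "K holomorphic_on - {0, 1}"
  shows "residue K 0 + residue K 1 = residue (\<lambda>w. K (1 / w) / w ^ 2) 0"
proof -
  let ?L = "\<lambda>w. K (1 / w) / w ^ 2"
  have out: "z \<noteq> 0 \<and> z \<noteq> 1" if "cmod z = 2" for z :: complex using that by auto
  have "contour_integral (circlepath 0 2) K =
      2 * pi * \<i> * (\<Sum>p\<in>{0, 1}. winding_number (circlepath 0 2) p * residue K p)"
    by (rule Residue_theorem[where S = UNIV])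
      (use holo out in \<open>auto simp: Compl_eq_Diff_UNIV\<close>)
  also have "(\<Sum>p\<in>{0, 1}. winding_number (circlepath 0 2) p * residue K p) = residue K 0 + residue K 1"
    by (simp add: winding_number_circlepath)
  finally have 1: "contour_integral (circlepath 0 2) K = 2 * pi * \<i> * (residue K 0 + residue K 1)" .
  have "K contour_integrable_on circlepath 0 2"
    by (rule contour_integrable_holomorphic_simple[OF holo]) (use out in auto)
  then have "(K has_contour_integral 2 * pi * \<i> * (residue K 0 + residue K 1)) (circlepath 0 2)"
    using 1 has_contour_integral_integral by fastforce
  from contour_integral_circlepath_inverse[OF _ this]
  have 2: "(?L has_contour_integral 2 * pi * \<i> * (residue K 0 + residue K 1)) (circlepath 0 (1 / 2))"
    by simp
  have "(?L has_contour_integral 2 * pi * \<i> * residue ?L 0) (circlepath 0 (1 / 2))"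
  proof (rule base_residue[where s = "ball 0 1"])
    have "(K \<circ> (\<lambda>w. 1 / w)) holomorphic_on ball 0 1 - {0}"
      by (rule holomorphic_on_compose_gen[OF _ holo]) (auto intro!: holomorphic_intros)
    then show "?L holomorphic_on ball 0 1 - {0}"
      by (intro holomorphic_intros) (auto simp: o_def)
  qed auto
  from has_contour_integral_unique[OF 2 this] show ?thesis by simp
qed

text \<open>
  The sum of the residues of \<open>z^p (z - 1)^r h(z) dz\<close>, written in terms of the expansions of \<open>h\<close>. The
  factor that is not a power of the local coordinate is expanded binomially: \<open>z^p\<close> at 1 and
  \<open>(z - 1)^r\<close> at 0 and at infinity, where it equals \<open>w^(-r) (1 - w)^r\<close> in the coordinate \<open>w = 1/z\<close>.
\<close>

lemma three_point_coefficient_identity: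
  fixes h :: "complex \<Rightarrow> complex"
  assumes holo: "h holomorphic_on - {0, 1}"
    and C: "h has_laurent_expansion C"
    and E: "(\<lambda>x. h (1 + x)) has_laurent_expansion E"
    and A: "(\<lambda>w. h (1 / w)) has_laurent_expansion A"
  shows "Sum_any (\<lambda>i::nat. (of_int p gchoose i) * fls_nth E (- 1 - r - int i)) =
    Sum_any (\<lambda>i::nat. (of_int r gchoose i) * (- 1) ^ i * fls_nth A (1 + p + r - int i)) -
    (- 1) powi r * Sum_any (\<lambda>i::nat. (of_int r gchoose i) * (- 1) ^ i * fls_nth C (- 1 - p - int i))"
proof -
  define K where "K z = z powi p * (z - 1) powi r * h z" for z
  have K_holo: "K holomorphic_on - {0, 1}"
    unfolding K_def by (intro holomorphic_intros holo) auto
  obtain C' where C': "(\<lambda>x. (1 + (- 1) * x) powi r * h x) has_laurent_expansion C'"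
    "\<And>k. fls_nth C' k = Sum_any (\<lambda>i::nat. (of_int r gchoose i) * (- 1) ^ i * fls_nth C (k - int i))"
    by (rule has_laurent_expansion_binomial_times[OF C, where e = "- 1" and n = r]) blast
  have "(\<lambda>x. (- 1) powi r * ((1 + (- 1) * x) powi r * h x * x powi p)) has_laurent_expansion
      fls_const ((- 1) powi r) * fls_shift (- p) C'"
    by (intro laurent_expansion_intros C')
  moreover have "(- 1) powi r * ((1 + (- 1) * x) powi r * h x * x powi p) = K x" for x
  proof -
    have "(x - 1) powi r = (- 1) powi r * (1 + (- 1) * x) powi r"
      by (subst power_int_mult_distrib[symmetric]) simp
    then show ?thesis by (simp add: K_def mult_ac)
  qed
  ultimately have "K has_laurent_expansion fls_const ((- 1) powi r) * fls_shift (- p) C'" by simp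
  from has_laurent_expansion_residue_0[OF this]
  have res0: "residue K 0 = (- 1) powi r *
      Sum_any (\<lambda>i::nat. (of_int r gchoose i) * (- 1) ^ i * fls_nth C (- 1 - p - int i))"
    by (simp add: C'(2))
  obtain E' where E': "(\<lambda>x. (1 + 1 * x) powi p * h (1 + x)) has_laurent_expansion E'"
    "\<And>k. fls_nth E' k = Sum_any (\<lambda>i::nat. (of_int p gchoose i) * 1 ^ i * fls_nth E (k - int i))"
    by (rule has_laurent_expansion_binomial_times[OF E, where e = 1 and n = p]) blast
  have "(\<lambda>x. (1 + 1 * x) powi p * h (1 + x) * x powi r) has_laurent_expansion fls_shift (- r) E'"
    by (intro laurent_expansion_intros E')
  also have "(\<lambda>x. (1 + 1 * x) powi p * h (1 + x) * x powi r) = (\<lambda>x. K (1 + x))"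
    by (auto simp: K_def mult_ac)
  finally have "residue K 1 = fls_residue (fls_shift (- r) E')"
    by (rule has_laurent_expansion_residue)
  then have res1: "residue K 1 = Sum_any (\<lambda>i::nat. (of_int p gchoose i) * fls_nth E (- 1 - r - int i))"
    by (simp add: E'(2))
  obtain A' where A': "(\<lambda>x. (1 + (- 1) * x) powi r * h (1 / x)) has_laurent_expansion A'"
    "\<And>k. fls_nth A' k = Sum_any (\<lambda>i::nat. (of_int r gchoose i) * (- 1) ^ i * fls_nth A (k - int i))"
    by (rule has_laurent_expansion_binomial_times[OF A, where e = "- 1" and n = r]) blast
  have "(\<lambda>x. (1 + (- 1) * x) powi r * h (1 / x) * x powi (- 2 - p - r)) has_laurent_expansion
      fls_shift (- (- 2 - p - r)) A'"
    by (intro laurent_expansion_intros A')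
  moreover have "eventually (\<lambda>w. (1 + (- 1) * w) powi r * h (1 / w) * w powi (- 2 - p - r) =
      K (1 / w) / w ^ 2) (at 0)"
  proof -
    have "eventually (\<lambda>w :: complex. w \<in> UNIV - {0}) (at 0)"
      by (intro eventually_at_in_open) auto
    then show ?thesis
    proof eventually_elim
      case (elim w)
      have "(1 / w - 1) powi r = (1 + (- 1) * w) powi r * w powi (- r)"
        using elim by (subst power_int_minus_left[symmetric] | simp add: power_int_minus
            power_int_divide_distrib[symmetric] divide_inverse[symmetric] diff_divide_distrib)+
      moreover have "w powi (- 2 - p - r) = w powi (- p) * w powi (- r) / w ^ 2"
        using elim by (simp add: power_int_diff power_int_minus divide_simps mult_ac)
      moreover have "(1 / w) powi p = w powi (- p)"
        by (simp add: power_int_minus power_int_divide_distrib divide_inverse power_int_inverse)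
      ultimately show ?case by (simp add: K_def)
    qed
  qed
  ultimately have "(\<lambda>w. K (1 / w) / w ^ 2) has_laurent_expansion fls_shift (- (- 2 - p - r)) A'"
    by (subst has_laurent_expansion_cong[OF _ refl, symmetric])
  from has_laurent_expansion_residue_0[OF this]
  have resinf: "residue (\<lambda>w. K (1 / w) / w ^ 2) 0 =
      Sum_any (\<lambda>i::nat. (of_int r gchoose i) * (- 1) ^ i * fls_nth A (1 + p + r - int i))"
    by (simp add: A'(2) algebra_simps)
  show ?thesis
    using residue_theorem_three_points[OF K_holo] unfolding res0 res1 resinf
    by (simp add: algebra_simps)
qed

section \<open>Homogeneous components of correlation functions\<close>

text \<open>
  This makes the sum in the definition of \<^const>\<open>expansion_02\<close> finite, which its linearity in the
  series depends on.
\<close>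

lemma laurent_series_shift_finite:
  assumes "a \<in> laurent_series"
  shows "finite {(i, k). a (p - real i) (p' - real k) \<noteq> 0}"
proof -
  obtain N :: int where N: "\<And>s t. a s t \<noteq> 0 \<Longrightarrow> of_int N < s \<and> of_int N < t"
    by (rule laurent_series_int_bound[OF assms]) blast
  have "i \<le> nat \<lceil>p - of_int N\<rceil> \<and> k \<le> nat \<lceil>p' - of_int N\<rceil>"
    if "a (p - real i) (p' - real k) \<noteq> 0" for i k
    using N[OF that] by linarith
  then have "{(i, k). a (p - real i) (p' - real k) \<noteq> 0} \<subseteq>
      {..nat \<lceil>p - of_int N\<rceil>} \<times> {..nat \<lceil>p' - of_int N\<rceil>}"
    by auto
  then show ?thesis by (rule finite_subset) auto
qed

lemma expansion_02_diagonal: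
  "expansion_02 \<alpha> \<beta> a p p' (\<alpha> - p) (\<beta> - p') =
   Sum_any (\<lambda>(i, k). complex_of_real ((\<alpha> gchoose i) * (\<beta> gchoose k)) *
     (- 1) powi \<lfloor>(p - real i) - (p' - real k)\<rfloor> * a (p - real i) (p' - real k))"
  by (simp add: expansion_02_def)

lemma expansion_02_add:
  assumes "a \<in> laurent_series" "b \<in> laurent_series"
  shows "expansion_02 \<alpha> \<beta> (\<lambda>s t. a s t + b s t) p p' q q' =
    expansion_02 \<alpha> \<beta> a p p' q q' + expansion_02 \<alpha> \<beta> b p p' q q'"
proof -
  let ?T = "\<lambda>a (i, k). complex_of_real ((\<alpha> gchoose i) * (\<beta> gchoose k)) *
     (- 1) powi \<lfloor>(p - real i) - (p' - real k)\<rfloor> * a (p - real i) (p' - real k)"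
  have fin: "finite {x. ?T c x \<noteq> 0}" if "c \<in> laurent_series" for c
    by (rule finite_subset[OF _ laurent_series_shift_finite[OF that]]) auto
  have "Sum_any (?T (\<lambda>s t. a s t + b s t)) = Sum_any (\<lambda>x. ?T a x + ?T b x)"
    by (rule Sum_any.cong) (simp add: case_prod_unfold ring_distribs)
  also have "\<dots> = Sum_any (?T a) + Sum_any (?T b)"
    by (rule Sum_any.distrib[OF fin[OF assms(1)] fin[OF assms(2)]])
  finally show ?thesis by (simp add: expansion_02_def)
qed

lemma expansion_02_scale:
  assumes "a \<in> laurent_series"
  shows "expansion_02 \<alpha> \<beta> (\<lambda>s t. c * a s t) p p' q q' = c * expansion_02 \<alpha> \<beta> a p p' q q'"
proof -
  let ?T = "\<lambda>a (i, k). complex_of_real ((\<alpha> gchoose i) * (\<beta> gchoose k)) *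
     (- 1) powi \<lfloor>(p - real i) - (p' - real k)\<rfloor> * a (p - real i) (p' - real k)"
  have fin: "finite {x. ?T a x \<noteq> 0}"
    by (rule finite_subset[OF _ laurent_series_shift_finite[OF assms]]) auto
  have "Sum_any (?T (\<lambda>s t. c * a s t)) = Sum_any (\<lambda>x. c * ?T a x)"
    by (rule Sum_any.cong) (simp add: case_prod_unfold mult_ac)
  also have "\<dots> = c * Sum_any (?T a)"
    by (rule Sum_any_right_distrib[OF fin, symmetric])
  finally show ?thesis by (simp add: expansion_02_def)
qed

lemma expansion_02_zero: "expansion_02 \<alpha> \<beta> (\<lambda>_ _. 0) p p' q q' = 0"
  by (simp add: expansion_02_def case_prod_unfold)

lemma real_analytic_zero: "real_analytic (\<lambda>_. 0) S"
  unfolding real_analytic_def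
proof
  fix z0
  show "\<exists>r>0. \<exists>c. \<forall>z\<in>ball z0 r. ((\<lambda>(m, n). c m n * complex_of_real
      (Re (z - z0) ^ m * Im (z - z0) ^ n)) has_sum 0) UNIV"
    by (rule exI[of _ 1], simp, rule exI[of _ "\<lambda>_ _. 0"]) (simp add: case_prod_unfold)
qed

lemma real_analytic_add:
  assumes "real_analytic f S" "real_analytic g S"
  shows "real_analytic (\<lambda>z. f z + g z) S"
  unfolding real_analytic_def
proof
  fix z0 assume "z0 \<in> S"
  obtain r c where "0 < r" and c: "\<And>z. z \<in> ball z0 r \<Longrightarrow>
     ((\<lambda>(m, n). c m n * complex_of_real (Re (z - z0) ^ m * Im (z - z0) ^ n)) has_sum f z) UNIV"
    using assms(1) \<open>z0 \<in> S\<close> unfolding real_analytic_def by blast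
  obtain s d where "0 < s" and d: "\<And>z. z \<in> ball z0 s \<Longrightarrow>
     ((\<lambda>(m, n). d m n * complex_of_real (Re (z - z0) ^ m * Im (z - z0) ^ n)) has_sum g z) UNIV"
    using assms(2) \<open>z0 \<in> S\<close> unfolding real_analytic_def by blast
  have "((\<lambda>(m, n). (c m n + d m n) * complex_of_real (Re (z - z0) ^ m * Im (z - z0) ^ n))
      has_sum f z + g z) UNIV" if "z \<in> ball z0 (min r s)" for z
    using has_sum_add[OF c[of z] d[of z]] that by (simp add: case_prod_unfold ring_distribs)
  moreover have "0 < min r s" using \<open>0 < r\<close> \<open>0 < s\<close> by simp
  ultimately show "\<exists>r>0. \<exists>c. \<forall>z\<in>ball z0 r. ((\<lambda>(m, n). c m n * complex_of_real
      (Re (z - z0) ^ m * Im (z - z0) ^ n)) has_sum f z + g z) UNIV"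
    by (intro exI[of _ "min r s"] exI[of _ "\<lambda>m n. c m n + d m n"] conjI ballI)
qed

lemma real_analytic_scale:
  assumes "real_analytic f S"
  shows "real_analytic (\<lambda>z. c * f z) S"
  unfolding real_analytic_def
proof
  fix z0 assume "z0 \<in> S"
  obtain r d where "0 < r" and d: "\<And>z. z \<in> ball z0 r \<Longrightarrow>
     ((\<lambda>(m, n). d m n * complex_of_real (Re (z - z0) ^ m * Im (z - z0) ^ n)) has_sum f z) UNIV"
    using assms(1) \<open>z0 \<in> S\<close> unfolding real_analytic_def by blast
  have "((\<lambda>(m, n). (c * d m n) * complex_of_real (Re (z - z0) ^ m * Im (z - z0) ^ n))
      has_sum c * f z) UNIV" if "z \<in> ball z0 r" for z
    using has_sum_cmult_right[OF d[OF that], of c] by (simp add: case_prod_unfold mult_ac)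
  then show "\<exists>r>0. \<exists>d. \<forall>z\<in>ball z0 r. ((\<lambda>(m, n). d m n * complex_of_real
      (Re (z - z0) ^ m * Im (z - z0) ^ n)) has_sum c * f z) UNIV" using \<open>0 < r\<close>
    by (intro exI[of _ r] exI[of _ "\<lambda>m n. c * d m n"] conjI ballI)
qed

text \<open>
  The data that a generator of GCor2 consists of, except for its degrees: a function on the sphere
  minus three points and its expansions in the charts \<open>z\<close>, \<open>1 - 1/z\<close> and \<open>1/z\<close>.
\<close>

definition three_expansions ::
  "(complex \<Rightarrow> complex) \<Rightarrow> complex coeffs \<Rightarrow> complex coeffs \<Rightarrow> complex coeffs \<Rightarrow> bool" where
  "three_expansions f a0 a1 ainf \<longleftrightarrow> real_analytic f (- {0, 1}) \<and> conv_expansion f a0 \<and>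
     conv_expansion (\<lambda>w. f (1 / (1 - w))) a1 \<and> conv_expansion (\<lambda>w. f (1 / w)) ainf"

lemma three_expansions_zero: "three_expansions (\<lambda>_. 0) (\<lambda>_ _. 0) (\<lambda>_ _. 0) (\<lambda>_ _. 0)"
  by (simp add: three_expansions_def real_analytic_zero conv_expansion_zero)

text \<open>
  Each expansion of a generator is concentrated in total degree \<open>(\<alpha>, \<beta>)\<close>. So the degree \<open>(\<alpha>, \<beta>)\<close> part of a
  linear combination comes from a single \<open>f\<close>, the combination of the functions of the
  generators with exactly these degrees.
\<close>

lemma gcor2_homogeneous_component:
  assumes "gcor2 \<mu> e12 e02 e21"
  shows "\<exists>f a0 a1 ainf. three_expansions f a0 a1 ainf \<and>
     (\<forall>q q'. e12 (\<alpha> - q) (\<beta> - q') q q' = a0 q q') \<and>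
     (\<forall>p p'. e02 p p' (\<alpha> - p) (\<beta> - p') = expansion_02 \<alpha> \<beta> a1 p p' (\<alpha> - p) (\<beta> - p')) \<and>
     (\<forall>q q'. e21 (\<alpha> - q) (\<beta> - q') q q' = ainf (- q) (- q'))"
  using assms
proof induction
  case (generator f \<alpha>' \<beta>' a0 a1 ainf)
  show ?case
  proof (cases "\<alpha>' = \<alpha> \<and> \<beta>' = \<beta>")
    case True
    have "three_expansions f a0 a1 ainf"
      using generator by (auto simp: three_expansions_def F01inf_def expands_as_imp_conv_expansion)
    then show ?thesis
      by (intro exI[of _ f] exI[of _ a0] exI[of _ a1] exI[of _ ainf])
        (use True in \<open>simp add: expansion_12_def expansion_21_def\<close>)
  next
    case False
    then have "expansion_12 \<alpha>' \<beta>' a0 (\<alpha> - q) (\<beta> - q') q q' = 0"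
        "expansion_02 \<alpha>' \<beta>' a1 q q' (\<alpha> - q) (\<beta> - q') = 0"
        "expansion_21 \<alpha>' \<beta>' ainf (\<alpha> - q) (\<beta> - q') q q' = 0" for q q'
      by (auto simp: expansion_12_def expansion_21_def expansion_02_def)
    then show ?thesis
      by (intro exI[of _ "\<lambda>_. 0"] exI[of _ "\<lambda>_ _. 0"])
        (simp add: three_expansions_zero expansion_02_zero)
  qed
next
  case zero
  show ?case
    by (intro exI[of _ "\<lambda>_. 0"] exI[of _ "\<lambda>_ _. 0"])
      (simp add: three_expansions_zero expansion_02_zero)
next
  case (add \<mu> e12 e02 e21 \<nu> d12 d02 d21)
  then obtain f a0 a1 ainf g b0 b1 binf where f: "three_expansions f a0 a1 ainf" "three_expansions g b0 b1 binf"
    and eqs: "\<forall>q q'. e12 (\<alpha> - q) (\<beta> - q') q q' = a0 q q'"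
     "\<forall>p p'. e02 p p' (\<alpha> - p) (\<beta> - p') = expansion_02 \<alpha> \<beta> a1 p p' (\<alpha> - p) (\<beta> - p')"
     "\<forall>q q'. e21 (\<alpha> - q) (\<beta> - q') q q' = ainf (- q) (- q')"
     "\<forall>q q'. d12 (\<alpha> - q) (\<beta> - q') q q' = b0 q q'"
     "\<forall>p p'. d02 p p' (\<alpha> - p) (\<beta> - p') = expansion_02 \<alpha> \<beta> b1 p p' (\<alpha> - p) (\<beta> - p')"
     "\<forall>q q'. d21 (\<alpha> - q) (\<beta> - q') q q' = binf (- q) (- q')"
    by metis
  have "three_expansions (\<lambda>z. f z + g z) (\<lambda>s t. a0 s t + b0 s t) (\<lambda>s t. a1 s t + b1 s t)
      (\<lambda>s t. ainf s t + binf s t)"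
    using f by (simp add: three_expansions_def real_analytic_add conv_expansion_add)
  moreover have "a1 \<in> laurent_series" "b1 \<in> laurent_series"
    using f by (auto simp: three_expansions_def conv_expansion_def)
  ultimately show ?case using eqs
    by (intro exI conjI) (assumption | simp add: expansion_02_add)+
next
  case (scale \<mu> e12 e02 e21 c)
  then obtain f a0 a1 ainf where f: "three_expansions f a0 a1 ainf"
    and eqs: "\<forall>q q'. e12 (\<alpha> - q) (\<beta> - q') q q' = a0 q q'"
     "\<forall>p p'. e02 p p' (\<alpha> - p) (\<beta> - p') = expansion_02 \<alpha> \<beta> a1 p p' (\<alpha> - p) (\<beta> - p')"
     "\<forall>q q'. e21 (\<alpha> - q) (\<beta> - q') q q' = ainf (- q) (- q')"
    by metis
  have "three_expansions (\<lambda>z. c * f z) (\<lambda>s t. c * a0 s t) (\<lambda>s t. c * a1 s t) (\<lambda>s t. c * ainf s t)"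
    using f by (simp add: three_expansions_def real_analytic_scale conv_expansion_scale)
  moreover have "a1 \<in> laurent_series"
    using f by (auto simp: three_expansions_def conv_expansion_def)
  ultimately show ?case using eqs
    by (intro exI conjI) (assumption | simp add: expansion_02_scale)+
qed

text \<open>
  Multiplication by \<open>(1 + x)^\<alpha> (1 + xbar)^\<beta>\<close> does not change the terms of lowest degree. So an exponent of
  \<open>a\<close> outside \<open>Q\<close>, chosen with minimal total degree, would survive in the product:
  contributions from lower exponents of \<open>a\<close> come from inside \<open>Q\<close> and stay there. Taking the condition
  \<open>\<beta> gchoose k \<noteq> 0\<close> into account allows \<open>Q\<close> to be contained in the line \<open>p' = 0\<close> if \<open>\<beta> = 0\<close>.
\<close>

lemma expansion_02_support:
  assumes "a \<in> laurent_series"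
    and supp: "\<And>p p'. expansion_02 \<alpha> \<beta> a p p' (\<alpha> - p) (\<beta> - p') \<noteq> 0 \<Longrightarrow> Q p p'"
    and closed: "\<And>p p' i k. Q p p' \<Longrightarrow> \<beta> gchoose k \<noteq> 0 \<Longrightarrow> Q (p + real i) (p' + real k)"
    and nz: "a p p' \<noteq> 0"
  shows "Q p p'"
proof (rule ccontr)
  assume "\<not> Q p p'"
  define B where "B = {(s, t). a s t \<noteq> 0 \<and> s + t \<le> p + p'} \<inter> {(s, t). \<not> Q s t}"
  have "finite {(s, t). a s t \<noteq> 0 \<and> s + t \<le> p + p'}"
    using assms(1) unfolding laurent_series_def by blast
  then have "finite B" "B \<noteq> {}" using nz \<open>\<not> Q p p'\<close> by (auto simp: B_def)
  then obtain x where x: "is_arg_min (\<lambda>(s, t). s + t) (\<lambda>x. x \<in> B) x"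
    using ex_is_arg_min_if_finite by blast
  obtain s t where st: "x = (s, t)" by (cases x)
  have B: "a s t \<noteq> 0" "s + t \<le> p + p'" "\<not> Q s t"
    using x by (auto simp: st is_arg_min_def B_def)
  have least: "s + t \<le> s' + t'" if "a s' t' \<noteq> 0" "\<not> Q s' t'" for s' t'
  proof (rule ccontr)
    assume "\<not> s + t \<le> s' + t'"
    then have "(s', t') \<in> B" using that B by (auto simp: B_def)
    then have "\<not> s' + t' < s + t" using x by (auto simp: st is_arg_min_def)
    then show False using \<open>\<not> s + t \<le> s' + t'\<close> by linarith
  qed
  have "(\<lambda>(i, k). complex_of_real ((\<alpha> gchoose i) * (\<beta> gchoose k)) *
     (- 1) powi \<lfloor>(s - real i) - (t - real k)\<rfloor> * a (s - real i) (t - real k)) =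
     (\<lambda>x. if x = (0, 0) then (- 1) powi \<lfloor>s - t\<rfloor> * a s t else 0)"
  proof (rule ext, clarify)
    fix i k :: nat
    show "complex_of_real ((\<alpha> gchoose i) * (\<beta> gchoose k)) * (- 1) powi \<lfloor>(s - real i) - (t - real k)\<rfloor> *
        a (s - real i) (t - real k) = (if (i, k) = (0, 0) then (- 1) powi \<lfloor>s - t\<rfloor> * a s t else 0)"
    proof (cases "i = 0 \<and> k = 0")
      case False
      have "a (s - real i) (t - real k) = 0 \<or> \<beta> gchoose k = 0"
      proof (rule ccontr)
        assume *: "\<not> (a (s - real i) (t - real k) = 0 \<or> \<beta> gchoose k = 0)"
        then have "\<not> Q (s - real i) (t - real k)"
          using closed[of "s - real i" "t - real k" k i] B by auto
        then show False using least[of "s - real i" "t - real k"] * False by auto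
      qed
      then show ?thesis using False by auto
    qed auto
  qed
  then have "expansion_02 \<alpha> \<beta> a s t (\<alpha> - s) (\<beta> - t) = (- 1) powi \<lfloor>s - t\<rfloor> * a s t"
    unfolding expansion_02_diagonal by (simp only: Sum_any.delta)
  then show False using supp[of s t] B by auto
qed

section \<open>Transport of expansions between the punctures\<close>

text \<open>
  At \<open>z = z2/z1\<close> the chart \<open>1 - 1/z\<close> takes the value \<open>- z0/z2\<close>, while \<open>Y(Y(a)b)\<close> is expanded in
  \<open>z0/z2\<close>; this lemma accounts for the sign.
\<close>

lemma conv_expansion_uminus:
  assumes "conv_expansion g a"
  shows "conv_expansion (\<lambda>z. g (- z)) (\<lambda>s t. (- 1) powi \<lfloor>s - t\<rfloor> * a s t)"
proof -
  have zpow: "zpow (- z) s t = (- 1) powi \<lfloor>s - t\<rfloor> * zpow z s t" for z s t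
    using power_int_mult_distrib[of "- 1" z "\<lfloor>s - t\<rfloor>"] by (simp add: zpow_def)
  obtain d where "0 < d" and d: "\<And>z. 0 < cmod z \<Longrightarrow> cmod z < d \<Longrightarrow>
      ((\<lambda>(s, t). a s t * zpow z s t) has_sum g z) UNIV"
    using assms(1) unfolding conv_expansion_def by blast
  have "((\<lambda>(s, t). ((- 1) powi \<lfloor>s - t\<rfloor> * a s t) * zpow z s t) has_sum g (- z)) UNIV"
    if "0 < cmod z" "cmod z < d" for z
    using d[of "- z"] that by (simp add: zpow mult_ac)
  moreover have "(\<lambda>s t. (- 1) powi \<lfloor>s - t\<rfloor> * a s t) \<in> laurent_series"
    using assms by (simp add: conv_expansion_def laurent_series_def formal_series_def)
  ultimately show ?thesis using \<open>0 < d\<close> unfolding conv_expansion_def by blast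
qed

lemma three_expansions_holomorphic:
  assumes "three_expansions f a0 a1 ainf" and holo: "f holomorphic_on ball 0 d - {0}" "0 < d"
  shows "f holomorphic_on - {0, 1}"
proof (rule real_analytic_holomorphic_continuation)
  define e where "e = min d 1 / 2"
  have e: "0 < e" "e < d" "e < 1" "2 * e \<le> d" using \<open>0 < d\<close> by (auto simp: e_def)
  show "real_analytic f (- {0, 1})" using assms by (simp add: three_expansions_def)
  show "connected (- {0, 1 :: complex})"
    unfolding Compl_eq_Diff_UNIV by (rule connected_open_delete_finite) auto
  show "open (- {0, 1 :: complex})" by (simp add: open_Compl)
  show "complex_of_real e \<in> - {0, 1}" using e by auto
  have "ball (complex_of_real e) e \<subseteq> ball 0 d - {0}"
  proof
    fix z assume z: "z \<in> ball (complex_of_real e) e"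
    have "cmod z \<le> cmod (z - of_real e) + cmod (of_real e)"
      using norm_triangle_ineq[of "z - of_real e" "of_real e"] by simp
    then have "cmod z < d" using z e by (simp add: dist_norm norm_minus_commute)
    moreover have "z \<noteq> 0" using z e by (auto simp: dist_norm)
    ultimately show "z \<in> ball 0 d - {0}" by simp
  qed
  then show "f holomorphic_on ball (complex_of_real e) e"
    using holo(1) holomorphic_on_subset by blast
qed (use assms in \<open>simp\<close>)

text \<open>
  The constant extends from a neighbourhood of 0 to the whole domain by analytic continuation, and the
  expansion at 1 is then determined by uniqueness. The support condition makes all exponents
  of \<open>a1\<close> integral, as the uniqueness lemma requires.
\<close>

lemma three_expansions_constant:
  assumes f: "three_expansions f a0 a1 ainf"
    and a0: "\<And>s t. a0 s t = (if s = 0 \<and> t = 0 then C else 0)"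
    and supp: "\<And>p p'. expansion_02 \<alpha> \<beta> a1 p p' (\<alpha> - p) (\<beta> - p') \<noteq> 0 \<Longrightarrow> p \<in> \<int> \<and> p' \<in> \<int>"
  shows "a1 s t = (if s = 0 \<and> t = 0 then C else 0)"
proof -
  obtain d where "0 < d" and d: "\<And>z. 0 < cmod z \<Longrightarrow> cmod z < d \<Longrightarrow>
      ((\<lambda>(s, t). a0 s t * zpow z s t) has_sum f z) UNIV"
    using f unfolding three_expansions_def conv_expansion_def by blast
  have near: "f z = C" if z: "z \<in> ball 0 d - {0}" for z
  proof -
    have "((\<lambda>(s, t). a0 s t * zpow z s t) has_sum C) UNIV"
      by (rule has_sum_finite_neutralI[of "{(0, 0)}"]) (use z in \<open>auto simp: a0 zpow_def split: if_splits\<close>)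
    then show ?thesis using d[of z] z has_sum_unique by force
  qed
  have "f holomorphic_on ball 0 d - {0} \<longleftrightarrow> (\<lambda>_. C) holomorphic_on ball 0 d - {0}"
    by (rule holomorphic_cong) (use near in auto)
  then have holo: "f holomorphic_on - {0, 1}"
    using three_expansions_holomorphic[OF f _ \<open>0 < d\<close>] by simp
  have const: "f z = C" if "z \<in> - {0, 1}" for z
  proof (rule analytic_continuation_open[where s = "ball 0 (min d 1) - {0}" and s' = "- {0, 1}"
        and f = f and g = "\<lambda>_. C"])
    show "connected (- {0, 1 :: complex})"
      unfolding Compl_eq_Diff_UNIV by (rule connected_open_delete_finite) auto
    show "open (- {0, 1 :: complex})" by (simp add: open_Compl)
    have "complex_of_real (min d 1 / 2) \<in> ball 0 (min d 1) - {0}" using \<open>0 < d\<close> by auto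
    then show "ball 0 (min d 1) - {0 :: complex} \<noteq> {}" by blast
  qed (use holo near that in auto)
  have nonsing: "1 / (1 - w) \<in> - {0, 1}" if "0 < cmod w" "cmod w < 1" for w :: complex
    using that by (auto simp: field_simps)
  have Q: "s \<in> \<int> \<and> t \<in> \<int>" if "a1 s t \<noteq> 0" for s t
    by (rule expansion_02_support[where a = a1, OF _ supp _ that])
      (use f in \<open>auto simp: three_expansions_def conv_expansion_def\<close>)
  define \<delta> where "\<delta> = (\<lambda>(s :: real) (t :: real). if s = 0 \<and> t = 0 then 1 else 0 :: complex)"
  have "conv_expansion (\<lambda>_. 1) \<delta>"
    unfolding conv_expansion_def
  proof
    have "finite {(s, t). \<delta> s t \<noteq> 0 \<and> s + t \<le> R}" for R
      by (rule finite_subset[of _ "{(0, 0)}"]) (auto simp: \<delta>_def split: if_splits)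
    then show "\<delta> \<in> laurent_series"
      by (auto simp: laurent_series_def formal_series_def \<delta>_def intro!: exI[of _ "- 1"])
    have "((\<lambda>(s, t). \<delta> s t * zpow z s t) has_sum 1) UNIV" if "0 < cmod z" for z
      by (rule has_sum_finite_neutralI[of "{(0, 0)}"]) (use that in \<open>auto simp: \<delta>_def zpow_def split: if_splits\<close>)
    then show "\<exists>\<epsilon>>0. \<forall>z. 0 < cmod z \<and> cmod z < \<epsilon> \<longrightarrow> ((\<lambda>(s, t). \<delta> s t * zpow z s t) has_sum 1) UNIV"
      by (intro exI[of _ 1]) auto
  qed
  then have conv: "conv_expansion (\<lambda>w. f (1 / (1 - w)) + (- C) * 1) (\<lambda>s t. a1 s t + (- C) * \<delta> s t)"
    using f by (intro conv_expansion_add conv_expansion_scale) (auto simp: three_expansions_def)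
  have "a1 s t + (- C) * \<delta> s t = 0"
    by (rule conv_expansion_zero_unique[OF conv, of 1])
      (use Q const nonsing in \<open>auto simp: \<delta>_def split: if_splits\<close>)
  then show ?thesis by (auto simp: \<delta>_def)
qed

lemma of_real_gbinomial: "complex_of_real (x gchoose k) = of_real x gchoose k"
  by (simp add: gbinomial_prod_rev)

text \<open>
  The coefficient identity for \<open>h(z) = z^m f(1/z)\<close>, the restriction to \<open>(z1, z2) = (z, 1)\<close> of
  \<open>z1^m f(z2/z1)\<close>. Since the expansion of \<open>f\<close> at 0 is a Laurent series in \<open>z\<close> alone, \<open>f\<close> is holomorphic.
\<close>

lemma three_expansions_residue_identity:
  assumes f: "three_expansions f a0 a1 ainf"
    and a0: "\<And>s t. a0 s t \<noteq> 0 \<Longrightarrow> t = 0 \<and> s \<in> \<int>"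
    and ainf: "\<And>s t. ainf s t \<noteq> 0 \<Longrightarrow> t = 0 \<and> s \<in> \<int>"
    and e: "\<And>p p'. expansion_02 (of_int m) 0 a1 p p' (of_int m - p) (0 - p') \<noteq> 0 \<Longrightarrow> p' = 0 \<and> p \<in> \<int>"
  shows "Sum_any (\<lambda>i::nat. (of_int p gchoose i) * expansion_02 (of_int m) 0 a1
        (of_int (- 1 - r - int i)) 0 (of_int m - of_int (- 1 - r - int i)) (0 - 0)) =
    Sum_any (\<lambda>i::nat. (of_int r gchoose i) * (- 1) ^ i * a0 (of_int (1 + p + r - int i + m)) 0) -
    (- 1) powi r * Sum_any (\<lambda>i::nat. (of_int r gchoose i) * (- 1) ^ i *
      ainf (of_int (- 1 - p - int i - m)) 0)"
proof -
  define h where "h z = z powi m * f (1 / z)" for z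
  obtain A where A: "f has_laurent_expansion A" "\<And>n. fls_nth A n = a0 (of_int n) 0"
    using conv_expansion_imp_has_laurent_expansion[OF _ a0] f unfolding three_expansions_def by blast
  obtain C where C: "(\<lambda>w. f (1 / w)) has_laurent_expansion C" "\<And>n. fls_nth C n = ainf (of_int n) 0"
    using conv_expansion_imp_has_laurent_expansion[OF _ ainf] f unfolding three_expansions_def by blast
  have "isolated_singularity_at f 0"
    using has_laurent_expansion_isolated_0[OF A(1)] .
  then obtain d where "0 < d" "f analytic_on ball 0 d - {0}"
    unfolding isolated_singularity_at_def by blast
  then have f_holo: "f holomorphic_on - {0, 1}"
    using three_expansions_holomorphic[OF f analytic_imp_holomorphic] by blast
  have "(f \<circ> (\<lambda>z. 1 / z)) holomorphic_on - {0, 1}"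
    by (rule holomorphic_on_compose_gen[OF _ f_holo]) (auto intro!: holomorphic_intros)
  then have h_holo: "h holomorphic_on - {0, 1}"
    unfolding h_def by (intro holomorphic_intros) (auto simp: o_def)
  have "(\<lambda>z. f (1 / z) * z powi m) has_laurent_expansion fls_shift (- m) C"
    by (intro laurent_expansion_intros C)
  then have hC: "h has_laurent_expansion fls_shift (- m) C"
    by (simp add: h_def[abs_def] mult_ac)
  have "(\<lambda>w. f w * w powi (- m)) has_laurent_expansion fls_shift (- (- m)) A"
    by (intro laurent_expansion_intros A)
  moreover have "f w * w powi (- m) = h (1 / w)" for w
    by (simp add: h_def power_int_minus power_int_divide_distrib divide_inverse power_int_inverse)
  ultimately have hA: "(\<lambda>w. h (1 / w)) has_laurent_expansion fls_shift m A" by simp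
  have a1: "t = 0 \<and> s \<in> \<int>" if "a1 s t \<noteq> 0" for s t
    by (rule expansion_02_support[where a = a1 and \<alpha> = "of_int m" and \<beta> = 0 and Q = "\<lambda>p p'. p' = 0 \<and> p \<in> \<int>", OF _ e _ that])
      (use f in \<open>auto simp: three_expansions_def conv_expansion_def gbinomial_0_left split: if_splits\<close>)
  have "conv_expansion (\<lambda>x. f (1 / (1 - (- x)))) (\<lambda>s t. (- 1) powi \<lfloor>s - t\<rfloor> * a1 s t)"
    by (rule conv_expansion_uminus) (use f in \<open>auto simp: three_expansions_def\<close>)
  from conv_expansion_imp_has_laurent_expansion[OF this] a1
  obtain B where B: "(\<lambda>x. f (1 / (1 + x))) has_laurent_expansion B"
    "\<And>n. fls_nth B n = (- 1) powi n * a1 (of_int n) 0"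
    by auto
  obtain E where E: "(\<lambda>x. (1 + 1 * x) powi m * f (1 / (1 + x))) has_laurent_expansion E"
    "\<And>k. fls_nth E k = Sum_any (\<lambda>i::nat. (of_int m gchoose i) * 1 ^ i * fls_nth B (k - int i))"
    by (rule has_laurent_expansion_binomial_times[OF B(1), where e = 1 and n = m]) blast
  have hE: "(\<lambda>x. h (1 + x)) has_laurent_expansion E"
    using E(1) by (simp add: h_def[abs_def])
  have E_nth: "fls_nth E n = expansion_02 (of_int m) 0 a1 (of_int n) 0 (of_int m - of_int n) (0 - 0)" for n
  proof -
    let ?g = "\<lambda>i::nat. (of_int m gchoose i) * ((- 1) powi (n - int i) * a1 (of_int (n - int i)) 0)"
    let ?G = "\<lambda>(i, k). complex_of_real ((of_int m gchoose i) * (0 gchoose k)) *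
       (- 1) powi \<lfloor>(of_int n - real i) - (0 - real k)\<rfloor> * a1 (of_int n - real i) (0 - real k)"
    have G0: "?G (i, 0) = ?g i" for i
    proof -
      have "\<lfloor>(of_int n - real i) - (0 - real 0)\<rfloor> = n - int i" by linarith
      then show ?thesis by (simp add: of_real_gbinomial del: floor_diff_of_int)
    qed
    have Gk: "?G (i, k) = 0" if "k \<noteq> 0" for i k
      using that by (simp add: gbinomial_0_left)
    have "a1 \<in> laurent_series" using f by (auto simp: three_expansions_def conv_expansion_def)
    then have "finite {(i, k). a1 (of_int n - real i) (0 - real k) \<noteq> 0}"
      by (rule laurent_series_shift_finite)
    then have fin: "finite {x. ?G x \<noteq> 0}" by (rule rev_finite_subset) auto
    define I where "I = fst ` {x. ?G x \<noteq> 0}"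
    have "finite I" using fin by (simp add: I_def)
    have sub: "{x. ?G x \<noteq> 0} \<subseteq> (\<lambda>i. (i, 0)) ` I"
    proof
      fix x assume x: "x \<in> {x. ?G x \<noteq> 0}"
      obtain i k where ik: "x = (i, k)" by (cases x)
      then have "k = 0" using x Gk[of k i] by blast
      then show "x \<in> (\<lambda>i. (i, 0)) ` I" using x ik image_eqI[of i fst x "{x. ?G x \<noteq> 0}"]
        unfolding I_def by auto
    qed
    have "Sum_any ?G = sum ?G ((\<lambda>i. (i, 0)) ` I)"
      using \<open>finite I\<close> sub by (intro Sum_any.expand_superset) auto
    also have "\<dots> = sum ?g I"
      by (subst sum.reindex) (simp_all only: o_def G0, simp add: inj_on_def)
    also have "\<dots> = Sum_any ?g"
    proof (rule Sum_any.expand_superset[symmetric])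
      show "{i. ?g i \<noteq> 0} \<subseteq> I"
      proof
        fix i assume "i \<in> {i. ?g i \<noteq> 0}"
        then have "(i, 0) \<in> {x. ?G x \<noteq> 0}" using G0[of i] by simp
        then show "i \<in> I" unfolding I_def by (rule image_eqI[rotated]) simp
      qed
    qed fact
    finally show ?thesis unfolding expansion_02_diagonal E(2) B(2) by simp
  qed
  show ?thesis
    using three_point_coefficient_identity[OF h_holo hC hE hA, of p r]
    by (simp only: E_nth fls_shift_nth A(2) C(2)) (simp add: algebra_simps)
qed

section \<open>The restricted dual separates points\<close>

lemma Sum_any_additive:
  assumes "finite {i. g i \<noteq> 0}" "u 0 = 0" "\<And>x y. u (x + y) = u x + u y"
  shows "u (Sum_any g) = Sum_any (\<lambda>i. u (g i))"
proof -
  have "u (sum g A) = (\<Sum>i\<in>A. u (g i))" if "finite A" for A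
    using that by induction (simp_all add: assms)
  then have "u (Sum_any g) = (\<Sum>i\<in>{i. g i \<noteq> 0}. u (g i))"
    using assms(1) by (simp add: Sum_any.expand_set)
  also have "\<dots> = Sum_any (\<lambda>i. u (g i))"
    by (rule Sum_any.expand_superset[symmetric]) (use assms in auto)
  finally show ?thesis .
qed

context full_vertex_algebra
begin

definition component :: "'v \<Rightarrow> real \<times> real \<Rightarrow> 'v" where
  "component v = (THE x. (\<forall>h h'. x (h, h') \<in> grade h h') \<and> finite {d. x d \<noteq> 0} \<and> Sum_any x = v)"

lemma component:
  "component v (h, h') \<in> grade h h'" "finite {d. component v d \<noteq> 0}" "Sum_any (component v) = v"
proof -
  have "\<exists>!x :: real \<times> real \<Rightarrow> 'v. (\<forall>h h'. x (h, h') \<in> grade h h') \<and> finite {d. x d \<noteq> 0} \<and> Sum_any x = v"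
    using graded unfolding graded_by_def by blast
  from theI'[OF this] show "component v (h, h') \<in> grade h h'" "finite {d. component v d \<noteq> 0}"
    "Sum_any (component v) = v"
    unfolding component_def[symmetric] by blast+
qed

lemma component_eqI:
  assumes "\<And>h h'. x (h, h') \<in> grade h h'" "finite {d. x d \<noteq> 0}" "Sum_any x = v"
  shows "component v = x"
proof -
  have "\<exists>!x :: real \<times> real \<Rightarrow> 'v. (\<forall>h h'. x (h, h') \<in> grade h h') \<and> finite {d. x d \<noteq> 0} \<and> Sum_any x = v"
    using graded unfolding graded_by_def by blast
  then show ?thesis unfolding component_def by (rule the1_equality) (use assms in blast)
qed

lemma subspace_grade: "subspace (grade h h')"
  using graded unfolding graded_by_def by blast

lemma component_add: "component (v + w) = (\<lambda>d. component v d + component w d)"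
proof (rule component_eqI)
  show "finite {d. component v d + component w d \<noteq> 0}"
    by (rule finite_subset[OF _ finite_UnI[OF component(2)[of v] component(2)[of w]]]) auto
  show "Sum_any (\<lambda>d. component v d + component w d) = v + w"
    by (simp add: Sum_any.distrib component)
qed (use component subspace_grade subspace_add in blast)

lemma component_scale: "component (sc c v) = (\<lambda>d. sc c (component v d))"
proof (rule component_eqI)
  show "finite {d. sc c (component v d) \<noteq> 0}"
    by (rule finite_subset[OF _ component(2)[of v]]) auto
  show "Sum_any (\<lambda>d. sc c (component v d)) = sc c v"
    using Sum_any_additive[OF component(2)[of v], of "sc c"] by (simp add: component scale_right_distrib)
qed (use component subspace_grade subspace_scale in blast)

lemma component_homogeneous:
  assumes "w \<in> grade k k'" "d \<noteq> (k, k')"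
  shows "component w d = 0"
proof -
  have "component w = (\<lambda>d. if d = (k, k') then w else 0)"
  proof (rule component_eqI)
    show "finite {d. (if d = (k, k') then w else 0) \<noteq> 0}"
      by (rule finite_subset[of _ "{(k, k')}"]) auto
    show "Sum_any (\<lambda>d. if d = (k, k') then w else 0) = w" by (rule Sum_any.delta)
  qed (use assms subspace_grade subspace_0 in auto)
  with assms show ?thesis by simp
qed

text \<open>
  A nonzero vector has a nonzero homogeneous component, and a linear functional that detects it,
  composed with the projection to this component, lies in the restricted dual.
\<close>

lemma restricted_dual_separates:
  assumes "\<And>u. u \<in> restricted_dual sc grade \<Longrightarrow> u v = 0"
  shows "v = 0"
proof (rule ccontr)
  assume "v \<noteq> 0"
  have "\<exists>d. component v d \<noteq> 0"
  proof (rule ccontr)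
    assume "\<not> (\<exists>d. component v d \<noteq> 0)"
    then have "component v = (\<lambda>_. 0)" by auto
    then have "v = 0" using component(3)[of v] by simp
    with \<open>v \<noteq> 0\<close> show False by simp
  qed
  then obtain d where d: "component v d \<noteq> 0" by blast
  interpret C: vector_space "(*) :: complex \<Rightarrow> complex \<Rightarrow> complex"
    by unfold_locales (simp_all add: algebra_simps)
  interpret P: vector_space_pair sc "(*) :: complex \<Rightarrow> complex \<Rightarrow> complex" ..
  have "independent {component v d}" using d by (simp add: dependent_single)
  then obtain \<phi> where \<phi>: "Vector_Spaces.linear sc (*) \<phi>" "\<phi> (component v d) = (1 :: complex)"
    using P.linear_independent_extend[of "{component v d}" "\<lambda>_. 1"] by auto
  interpret \<phi>: Vector_Spaces.linear sc "(*)" \<phi> by (rule \<phi>(1))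
  have "(\<lambda>w. \<phi> (component w d)) \<in> restricted_dual sc grade"
    unfolding restricted_dual_def
  proof (intro CollectI conjI)
    show "Vector_Spaces.linear sc (*) (\<lambda>w. \<phi> (component w d))"
      using \<phi>(1) by (simp add: Vector_Spaces.linear_iff component_add component_scale)
    have "\<phi> (component w d) = 0" if "w \<in> grade h h'" "(h, h') \<noteq> d" for h h' w
      using component_homogeneous[OF that(1), of d] that(2) \<phi>.zero by simp
    then have "{(h, h'). \<exists>w\<in>grade h h'. \<phi> (component w d) \<noteq> 0} \<subseteq> {d}"
      by blast
    then show "finite {(h, h'). \<exists>w\<in>grade h h'. \<phi> (component w d) \<noteq> 0}"
      by (rule finite_subset) simp
  qed
  from assms[OF this] \<phi>(2) show False by simp
qed

section \<open>The kernel of Dbar\<close>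

lemma Y_add_left: "Y (a + b) r s c = Y a r s c + Y b r s c"
  and Y_scale_left: "Y (sc k a) r s c = sc k (Y a r s c)"
  using Y_linear[of r s c] unfolding Vector_Spaces.linear_iff by auto

lemma Y_add_right: "Y a r s (b + c) = Y a r s b + Y a r s c"
  and Y_scale_right: "Y a r s (sc k b) = sc k (Y a r s b)"
  using mode_linear[of a r s] unfolding Vector_Spaces.linear_iff by auto

lemma Y_zero_left [simp]: "Y 0 r s c = 0"
  using Y_scale_left[of 0 0 r s c] by simp

lemma Y_zero_right [simp]: "Y a r s 0 = 0"
  using Y_scale_right[of a r s 0 0] by simp

lemma dual_add: "u \<in> restricted_dual sc grade \<Longrightarrow> u (v + w) = u v + u w"
  and dual_scale: "u \<in> restricted_dual sc grade \<Longrightarrow> u (sc k v) = k * u v"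
  by (simp_all add: restricted_dual_def Vector_Spaces.linear_iff)

lemma dual_zero: "u \<in> restricted_dual sc grade \<Longrightarrow> u 0 = 0"
  using dual_scale[of u 0 0] by simp

lemma dual_diff: "u \<in> restricted_dual sc grade \<Longrightarrow> u (v - w) = u v - u w"
  using dual_add[of u "v - w" w] by simp

text \<open>
  The mode \<open>(- p - 1, - p' - 1)\<close> belongs to the exponents \<open>(p, p')\<close>; once the total degree \<open>(\<alpha>, \<beta>)\<close> is
  fixed, the exponents of one of the two variables determine those of the other.
\<close>

lemma correlator:
  assumes "u \<in> restricted_dual sc grade"
  obtains f a0 a1 ainf where "three_expansions f a0 a1 ainf"
    "\<And>q q'. u (Y a (- (\<alpha> - q) - 1) (- (\<beta> - q') - 1) (Y b (- q - 1) (- q' - 1) c)) = a0 q q'"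
    "\<And>p p'. u (Y (Y a (- p - 1) (- p' - 1) b) (- (\<alpha> - p) - 1) (- (\<beta> - p') - 1) c) =
       expansion_02 \<alpha> \<beta> a1 p p' (\<alpha> - p) (\<beta> - p')"
    "\<And>q q'. u (Y b (- q - 1) (- q' - 1) (Y a (- (\<alpha> - q) - 1) (- (\<beta> - q') - 1) c)) = ainf (- q) (- q')"
proof -
  obtain \<mu> where "gcor2 \<mu>
       (\<lambda>p p' q q'. u (Y a (- p - 1) (- p' - 1) (Y b (- q - 1) (- q' - 1) c)))
       (\<lambda>p p' q q'. u (Y (Y a (- p - 1) (- p' - 1) b) (- q - 1) (- q' - 1) c))
       (\<lambda>p p' q q'. u (Y b (- q - 1) (- q' - 1) (Y a (- p - 1) (- p' - 1) c)))"
    using FV5[OF assms] by blast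
  from gcor2_homogeneous_component[OF this, of \<alpha> \<beta>] show ?thesis
    by (elim exE conjE, intro that) (assumption, (erule allE, erule allE, assumption)+)
qed

text \<open>
  The case \<open>b = 1\<close> of the correlator shows that \<open>Y(Dbar a) = \<partial>bar Y(a)\<close>: the mode \<open>a(r, s)\<close> contributes the monomial
  of degree \<open>(- r - 1, - s - 1)\<close> to \<open>Y(a)\<close>, which is killed by \<open>\<partial>bar\<close> only if \<open>s = - 1\<close>. Integrality of \<open>r\<close> is then
  forced, as the two exponents differ by an integer.
\<close>

lemma ker_Dbar_modes:
  assumes a: "a \<in> ker_Dbar vac Y" and nz: "Y a r s c \<noteq> 0"
  shows "r \<in> \<int> \<and> s = - 1"
proof -
  have "s = - 1"
  proof (rule ccontr)
    assume "s \<noteq> - 1"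
    define \<alpha> \<beta> where "\<alpha> = - r - 1" and "\<beta> = - s - 1"
    have "\<beta> \<noteq> 0" using \<open>s \<noteq> - 1\<close> by (simp add: \<beta>_def)
    have "u (Y a r s c) = 0" if u: "u \<in> restricted_dual sc grade" for u
    proof -
      obtain f a0 a1 ainf where f: "three_expansions f a0 a1 ainf"
        and e12: "\<And>q q'. u (Y a (- (\<alpha> - q) - 1) (- (\<beta> - q') - 1) (Y vac (- q - 1) (- q' - 1) c)) = a0 q q'"
        and e02: "\<And>p p'. u (Y (Y a (- p - 1) (- p' - 1) vac) (- (\<alpha> - p) - 1) (- (\<beta> - p') - 1) c) =
          expansion_02 \<alpha> \<beta> a1 p p' (\<alpha> - p) (\<beta> - p')"
        by (rule correlator[OF u, of a \<alpha> \<beta> vac c]) blast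
      have a0: "a0 q q' = (if q = 0 \<and> q' = 0 then u (Y a r s c) else 0)" for q q'
        unfolding e12[symmetric] by (auto simp: FV4 \<alpha>_def \<beta>_def dual_zero[OF u])
      have supp: "p \<in> \<int> \<and> p' \<in> \<int>" if "expansion_02 \<alpha> \<beta> a1 p p' (\<alpha> - p) (\<beta> - p') \<noteq> 0" for p p'
      proof -
        have "Y a (- p - 1) (- p' - 1) vac \<noteq> 0"
          using that unfolding e02[symmetric] by (auto simp: dual_zero[OF u])
        then have "p \<in> \<nat> \<and> p' \<in> \<nat>" using FV3(1)[of a] by (simp add: power_series_def)
        then show ?thesis using Nats_subset_Ints by blast
      qed
      have a1: "a1 p p' = (if p = 0 \<and> p' = 0 then u (Y a r s c) else 0)" for p p'
        by (rule three_expansions_constant[OF f a0 supp])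
      \<comment> \<open>the coefficient of \<open>xbar\<close> in \<open>C (1 + x)^\<alpha> (1 + xbar)^\<beta>\<close>, where \<open>C = u (a(r, s) c)\<close>\<close>
      have "(\<lambda>(i, k). complex_of_real ((\<alpha> gchoose i) * (\<beta> gchoose k)) *
         (- 1) powi \<lfloor>(0 - real i) - (1 - real k)\<rfloor> * a1 (0 - real i) (1 - real k)) =
         (\<lambda>x. if x = (0, 1) then of_real \<beta> * u (Y a r s c) else 0)"
        by (auto simp: a1 fun_eq_iff)
      then have "of_real \<beta> * u (Y a r s c) = expansion_02 \<alpha> \<beta> a1 0 1 (\<alpha> - 0) (\<beta> - 1)"
        unfolding expansion_02_diagonal by (simp only: Sum_any.delta)
      also have "\<dots> = u (Y (Y a (- 1) (- 2) vac) (- (\<alpha> - 0) - 1) (- (\<beta> - 1) - 1) c)"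
        using e02[of 0 1] by simp
      also have "\<dots> = 0"
        using a by (simp add: ker_Dbar_def Dbar_def dual_zero[OF u])
      finally show ?thesis using \<open>\<beta> \<noteq> 0\<close> by simp
    qed
    then have "Y a r s c = 0" by (rule restricted_dual_separates)
    with nz show False by simp
  qed
  moreover have "r \<in> \<int>"
  proof -
    have "(- r - 1) - (- s - 1) \<in> \<int>"
    proof -
      have "\<forall>p q. Y a (- p - 1) (- q - 1) c \<noteq> 0 \<longrightarrow> p - q \<in> \<int>"
        using Y_formal[of a c] by (simp add: formal_series_def)
      from this[rule_format, of "- r - 1" "- s - 1"] show ?thesis using nz by simp
    qed
    then have "- (- (r + 1)) \<in> \<int>" using \<open>s = - 1\<close> by (intro Ints_minus) simp
    then have "(r + 1) - 1 \<in> \<int>" by (intro Ints_diff) auto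
    then show ?thesis by simp
  qed
  ultimately show ?thesis by simp
qed

text \<open>
  The vector \<open>Dbar (a(r, s) b)\<close> is a coefficient of \<open>Y(Y(a)b)1\<close> in total degree \<open>(- r - 1, 1)\<close> if \<open>s = - 1\<close>. In this
  degree \<open>Y(a)Y(b)1\<close> vanishes, because the modes of \<open>a\<close> and \<open>b\<close> only produce degree 0 in the
  conjugate variables. Hence the function \<open>f\<close> vanishes, and all its expansions do.
\<close>

lemma ker_Dbar_closed:
  assumes a: "a \<in> ker_Dbar vac Y" and b: "b \<in> ker_Dbar vac Y"
  shows "Y a r s b \<in> ker_Dbar vac Y"
proof -
  have "u (Y (Y a r s b) (- 1) (- 2) vac) = 0" if u: "u \<in> restricted_dual sc grade" for u
  proof (cases "s = - 1")
    case True
    define \<alpha> where "\<alpha> = - r - 1"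
    obtain f a0 a1 ainf where f: "three_expansions f a0 a1 ainf"
      and e12: "\<And>q q'. u (Y a (- (\<alpha> - q) - 1) (- (1 - q') - 1) (Y b (- q - 1) (- q' - 1) vac)) = a0 q q'"
      and e02: "\<And>p p'. u (Y (Y a (- p - 1) (- p' - 1) b) (- (\<alpha> - p) - 1) (- (1 - p') - 1) vac) =
        expansion_02 \<alpha> 1 a1 p p' (\<alpha> - p) (1 - p')"
      by (rule correlator[OF u, of a \<alpha> 1 b vac]) blast
    have a0: "a0 q q' = (if q = 0 \<and> q' = 0 then 0 else 0)" for q q'
    proof (rule ccontr)
      assume "a0 q q' \<noteq> (if q = 0 \<and> q' = 0 then 0 else 0)"
      then have *: "Y a (- (\<alpha> - q) - 1) (- (1 - q') - 1) (Y b (- q - 1) (- q' - 1) vac) \<noteq> 0"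
        unfolding e12[symmetric] by (auto simp: dual_zero[OF u])
      then have "Y b (- q - 1) (- q' - 1) vac \<noteq> 0" by auto
      then show False using ker_Dbar_modes[OF a *] ker_Dbar_modes[OF b] by fastforce
    qed
    have supp: "p \<in> \<int> \<and> p' \<in> \<int>" if "expansion_02 \<alpha> 1 a1 p p' (\<alpha> - p) (1 - p') \<noteq> 0" for p p'
    proof -
      have "Y a (- p - 1) (- p' - 1) b \<noteq> 0"
        using that unfolding e02[symmetric] by (auto simp: dual_zero[OF u])
      from ker_Dbar_modes[OF a this] have "- (- p - 1) - 1 \<in> \<int>" "p' = 0"
        by (auto intro!: Ints_diff Ints_minus)
      then show ?thesis by simp
    qed
    have a1: "a1 = (\<lambda>_ _. 0)"
      using three_expansions_constant[OF f a0 supp] by (auto simp: fun_eq_iff)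
    have "u (Y (Y a r s b) (- 1) (- 2) vac) = expansion_02 \<alpha> 1 a1 \<alpha> 0 (\<alpha> - \<alpha>) (1 - 0)"
      using e02[of \<alpha> 0] True by (simp add: \<alpha>_def)
    then show ?thesis by (simp add: a1 expansion_02_zero)
  next
    case False
    then have "Y a r s b = 0" using ker_Dbar_modes[OF a] by blast
    then show ?thesis by (simp add: dual_zero[OF u])
  qed
  then show ?thesis
    using restricted_dual_separates by (simp add: ker_Dbar_def Dbar_def)
qed

lemma modes_truncate: "\<exists>N. \<forall>n\<ge>N. Y a (of_int n) s w = 0"
proof -
  obtain N :: int where N: "\<And>p q. Y a (- p - 1) (- q - 1) w \<noteq> 0 \<Longrightarrow> of_int N < p \<and> of_int N < q"
    using laurent_series_int_bound[OF FV1[of a w]] by blast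
  have "Y a (of_int n) s w = 0" if "n \<ge> - N - 1" for n
  proof (rule ccontr)
    assume "Y a (of_int n) s w \<noteq> 0"
    then have "real_of_int N < - of_int n - 1" using N[of "- of_int n - 1" "- s - 1"] by simp
    then show False using that by linarith
  qed
  then show ?thesis by blast
qed

lemma modes_finite: "finite {i::nat. Y a (of_int (n + int i)) s w \<noteq> 0}"
proof -
  obtain N where N: "\<And>n. n \<ge> N \<Longrightarrow> Y a (of_int n) s w = 0" using modes_truncate by blast
  have "{i::nat. Y a (of_int (n + int i)) s w \<noteq> 0} \<subseteq> {..nat (N - n)}"
  proof
    fix i assume "i \<in> {i::nat. Y a (of_int (n + int i)) s w \<noteq> 0}"
    then have "\<not> n + int i \<ge> N" using N by blast
    then show "i \<in> {..nat (N - n)}" by auto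
  qed
  then show ?thesis by (rule finite_subset) simp
qed

text \<open>
  Applied to a functional \<open>u\<close>, both sides are finite linear combinations of matrix elements of total degree
  \<open>(- p - q - r - 2, 0)\<close>, and the equation between them is the residue identity for the function \<open>f\<close> of this degree.
\<close>

lemma ker_Dbar_borcherds:
  assumes a: "a \<in> ker_Dbar vac Y" and b: "b \<in> ker_Dbar vac Y"
  shows "Sum_any (\<lambda>i. sc (of_int p gchoose i)
       (Y (Y a (of_int (r + int i)) (- 1) b) (of_int (p + q - int i)) (- 1) w)) =
     Sum_any (\<lambda>i. sc ((- 1) ^ i * (of_int r gchoose i))
       (Y a (of_int (p + r - int i)) (- 1) (Y b (of_int (q + int i)) (- 1) w)
        - sc ((- 1) powi r) (Y b (of_int (q + r - int i)) (- 1) (Y a (of_int (p + int i)) (- 1) w))))"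
    (is "Sum_any ?L = Sum_any ?R")
proof -
  let ?E = "\<lambda>i. Y (Y a (of_int (r + int i)) (- 1) b) (of_int (p + q - int i)) (- 1) w"
  let ?A = "\<lambda>i. Y a (of_int (p + r - int i)) (- 1) (Y b (of_int (q + int i)) (- 1) w)"
  let ?C = "\<lambda>i. Y b (of_int (q + r - int i)) (- 1) (Y a (of_int (p + int i)) (- 1) w)"
  have finE: "finite {i. ?E i \<noteq> 0}"
    by (rule finite_subset[OF _ modes_finite[of a r "- 1" b]]) auto
  have finA: "finite {i. ?A i \<noteq> 0}"
    by (rule finite_subset[OF _ modes_finite[of b q "- 1" w]]) auto
  have finC: "finite {i. ?C i \<noteq> 0}"
    by (rule finite_subset[OF _ modes_finite[of a p "- 1" w]]) auto
  have finL: "finite {i. ?L i \<noteq> 0}"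
    by (rule finite_subset[OF _ finE]) auto
  have finR: "finite {i. ?R i \<noteq> 0}"
    by (rule finite_subset[OF _ finite_UnI[OF finA finC]]) auto
  have "u (Sum_any ?L - Sum_any ?R) = 0" if u: "u \<in> restricted_dual sc grade" for u
  proof -
    note u_simps = dual_zero[OF u] dual_add[OF u] dual_diff[OF u] dual_scale[OF u]
    \<comment> \<open>the total degree in \<open>(z1, z2)\<close> common to all terms of the identity\<close>
    define m where "m = - p - q - r - 2"
    obtain f a0 a1 ainf where f: "three_expansions f a0 a1 ainf"
      and e12: "\<And>x x'. u (Y a (- (of_int m - x) - 1) (- (0 - x') - 1) (Y b (- x - 1) (- x' - 1) w)) = a0 x x'"
      and e02: "\<And>x x'. u (Y (Y a (- x - 1) (- x' - 1) b) (- (of_int m - x) - 1) (- (0 - x') - 1) w) =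
        expansion_02 (of_int m) 0 a1 x x' (of_int m - x) (0 - x')"
      and e21: "\<And>x x'. u (Y b (- x - 1) (- x' - 1) (Y a (- (of_int m - x) - 1) (- (0 - x') - 1) w)) =
        ainf (- x) (- x')"
      by (rule correlator[OF u, of a "of_int m" 0 b w]) blast
    have int: "x \<in> \<int> \<and> x' = 0" if "- x - 1 \<in> \<int> \<and> - x' - 1 = - 1" for x x' :: real
    proof -
      have "- (- x - 1) - 1 \<in> \<int>" using that by (intro Ints_diff Ints_minus) auto
      then show ?thesis using that by simp
    qed
    have a0: "t = 0 \<and> s \<in> \<int>" if "a0 s t \<noteq> 0" for s t
    proof -
      have "Y b (- s - 1) (- t - 1) w \<noteq> 0" using that unfolding e12[symmetric] by (auto simp: u_simps)
      from int[OF ker_Dbar_modes[OF b this]] show ?thesis by simp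
    qed
    have ainf: "t = 0 \<and> s \<in> \<int>" if "ainf s t \<noteq> 0" for s t
    proof -
      have "Y b (- (- s) - 1) (- (- t) - 1) (Y a (- (of_int m - (- s)) - 1) (- (0 - (- t)) - 1) w) \<noteq> 0"
        using that e21[of "- s" "- t"] by (auto simp: u_simps)
      from int[OF ker_Dbar_modes[OF b this]] have "- (- s) \<in> \<int> \<and> t = 0" by (auto intro: Ints_minus)
      then show ?thesis by simp
    qed
    have supp: "x' = 0 \<and> x \<in> \<int>" if "expansion_02 (of_int m) 0 a1 x x' (of_int m - x) (0 - x') \<noteq> 0" for x x'
    proof -
      have "Y a (- x - 1) (- x' - 1) b \<noteq> 0" using that unfolding e02[symmetric] by (auto simp: u_simps)
      from int[OF ker_Dbar_modes[OF a this]] show ?thesis by simp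
    qed
    have E: "expansion_02 (of_int m) 0 a1 (of_int (- 1 - r - int i)) 0
        (of_int m - of_int (- 1 - r - int i)) (0 - 0) = u (?E i)" for i
      unfolding e02[symmetric] by (simp add: m_def algebra_simps)
    have A: "a0 (of_int (1 + p + r - int i + m)) 0 = u (?A i)" for i
      unfolding e12[symmetric] by (simp add: m_def algebra_simps)
    have C: "ainf (of_int (- 1 - p - int i - m)) 0 = u (?C i)" for i
      using e21[of "- of_int (- 1 - p - int i - m)" 0] by (simp add: m_def algebra_simps)
    have "u (Sum_any ?L) = Sum_any (\<lambda>i. (of_int p gchoose i) * u (?E i))"
      by (subst Sum_any_additive[OF finL]) (simp_all add: u_simps)
    also have "\<dots> = Sum_any (\<lambda>i. (of_int r gchoose i) * (- 1) ^ i * u (?A i)) -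
        (- 1) powi r * Sum_any (\<lambda>i. (of_int r gchoose i) * (- 1) ^ i * u (?C i))"
      unfolding E[symmetric] A[symmetric] C[symmetric]
      by (rule three_expansions_residue_identity[OF f]) (fact a0 ainf supp)+
    also have "\<dots> = Sum_any (\<lambda>i. (of_int r gchoose i) * (- 1) ^ i * u (?A i)) +
        Sum_any (\<lambda>i. - ((- 1) powi r) * ((of_int r gchoose i) * (- 1) ^ i * u (?C i)))"
    proof -
      have "finite {i. (of_int r gchoose i) * (- 1) ^ i * u (?C i) \<noteq> 0}"
        by (rule finite_subset[OF _ finC]) (auto simp: u_simps)
      from Sum_any_right_distrib[OF this, of "- ((- 1) powi r)"] show ?thesis by simp
    qed
    also have "\<dots> = Sum_any (\<lambda>i. (of_int r gchoose i) * (- 1) ^ i * u (?A i) +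
        - ((- 1) powi r) * ((of_int r gchoose i) * (- 1) ^ i * u (?C i)))"
    proof (rule Sum_any.distrib[symmetric])
      show "finite {i. (of_int r gchoose i) * (- 1) ^ i * u (?A i) \<noteq> 0}"
        by (rule finite_subset[OF _ finA]) (auto simp: u_simps)
      show "finite {i. - ((- 1) powi r) * ((of_int r gchoose i) * (- 1) ^ i * u (?C i)) \<noteq> 0}"
        by (rule finite_subset[OF _ finC]) (auto simp: u_simps)
    qed
    also have "\<dots> = Sum_any (\<lambda>i. u (?R i))"
      by (rule Sum_any.cong) (simp add: u_simps algebra_simps)
    also have "\<dots> = u (Sum_any ?R)"
      by (rule Sum_any_additive[OF finR, symmetric]) (simp_all add: u_simps)
    finally show ?thesis by (simp add: u_simps)
  qed
  then have "Sum_any ?L - Sum_any ?R = 0" by (rule restricted_dual_separates)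
  then show ?thesis by simp
qed

lemma subspace_ker_Dbar: "subspace (ker_Dbar vac Y)"
  by (simp add: subspace_def ker_Dbar_def Dbar_def Y_add_left Y_scale_left)

text \<open>
  The case \<open>W = UNIV\<close> is the module, and \<open>W\<close> the kernel itself is the adjoint module that enters
  the definition of a vertex algebra.
\<close>

lemma vertex_module_ker_Dbar:
  assumes "subspace W" "\<And>a w r. a \<in> ker_Dbar vac Y \<Longrightarrow> w \<in> W \<Longrightarrow> Y a r (- 1) w \<in> W"
  shows "vertex_module sc (ker_Dbar vac Y) vac (\<lambda>a n. Y a (of_int n) (- 1))
    sc W (\<lambda>a n. Y a (of_int n) (- 1))"
  unfolding vertex_module_def
proof (intro conjI ballI allI)
  fix a b w and p q r :: int
  assume "a \<in> ker_Dbar vac Y" "b \<in> ker_Dbar vac Y"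
  then show "Sum_any (\<lambda>i. sc (of_int p gchoose i)
       (Y (Y a (of_int (r + int i)) (- 1) b) (of_int (p + q - int i)) (- 1) w)) =
     Sum_any (\<lambda>i. sc ((- 1) ^ i * (of_int r gchoose i))
       (Y a (of_int (p + r - int i)) (- 1) (Y b (of_int (q + int i)) (- 1) w)
        - sc ((- 1) powi r) (Y b (of_int (q + r - int i)) (- 1) (Y a (of_int (p + int i)) (- 1) w))))"
    by (rule ker_Dbar_borcherds)
qed (use assms modes_truncate vector_space_axioms in
    \<open>auto simp: Y_add_left Y_scale_left Y_add_right Y_scale_right FV4\<close>)

lemma vertex_algebra_ker_Dbar:
  "vertex_algebra sc (ker_Dbar vac Y) vac (\<lambda>a n. Y a (of_int n) (- 1))"
  unfolding vertex_algebra_def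
proof (intro conjI ballI allI impI)
  show "vac \<in> ker_Dbar vac Y" by (simp add: ker_Dbar_def Dbar_def FV4)
  show "vertex_module sc (ker_Dbar vac Y) vac (\<lambda>a n. Y a (of_int n) (- 1))
    sc (ker_Dbar vac Y) (\<lambda>a n. Y a (of_int n) (- 1))"
    by (intro vertex_module_ker_Dbar subspace_ker_Dbar ker_Dbar_closed)
  fix a
  show "Y a (of_int (- 1)) (- 1) vac = a" using FV3(2) by simp
  fix n :: int assume "0 \<le> n"
  show "Y a (of_int n) (- 1) vac = 0"
  proof (rule ccontr)
    assume "Y a (of_int n) (- 1) vac \<noteq> 0"
    then have "- real_of_int n - 1 \<in> \<nat>"
    proof -
      have "\<forall>p q. Y a (- p - 1) (- q - 1) vac \<noteq> 0 \<longrightarrow> p \<in> \<nat> \<and> q \<in> \<nat>"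
        using FV3(1)[of a] by (simp add: power_series_def)
      from this[rule_format, of "- real_of_int n - 1" 0]
      show ?thesis using \<open>Y a (of_int n) (- 1) vac \<noteq> 0\<close> by simp
    qed
    then show False using \<open>0 \<le> n\<close> Nats_cases by force
  qed
qed

end

theorem proposition3p12:
  fixes sc :: "complex \<Rightarrow> 'v::ab_group_add \<Rightarrow> 'v"
    and grade :: "real \<Rightarrow> real \<Rightarrow> 'v set"
    and vac :: 'v
    and Y :: "'v \<Rightarrow> real \<Rightarrow> real \<Rightarrow> 'v \<Rightarrow> 'v"
  assumes "full_vertex_algebra sc grade vac Y"
  shows "(\<forall>a\<in>ker_Dbar vac Y. \<forall>r s b. Y a r s b \<noteq> 0 \<longrightarrow> r \<in> \<int> \<and> s = - 1) \<and>
    vertex_algebra sc (ker_Dbar vac Y) vac (\<lambda>a n. Y a (of_int n) (- 1)) \<and>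
    vertex_module sc (ker_Dbar vac Y) vac (\<lambda>a n. Y a (of_int n) (- 1))
      sc UNIV (\<lambda>a n. Y a (of_int n) (- 1))"
proof -
  interpret full_vertex_algebra sc grade vac Y by (rule assms)
  show ?thesis
    using ker_Dbar_modes vertex_algebra_ker_Dbar vertex_module_ker_Dbar[OF subspace_UNIV] by blast
qed

end
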